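(* Let $K$ be a compact open subgroup of $G$ with a strong $\sigma$-factorization for standard $\sigma$-parabolic subgroups. Let $P=MU$ be a standard $\sigma$-parabolic subgroup of $G$. Let $a\in A_\emptyset$ be $P_\emptyset$-dominant. Then: (i) $HaK=HaK_MK_U$, where $K_M=K\cap M$ and $K_U=K\cap U$. (ii) $\mathrm{vol}_X(\dot1aK)=\mathrm{vol}_{X_P}(\dot1_PaK)$.
   Context: $\mathbf F$ is a non-archimedean local field of characteristic different from $2$, with normalized absolute value $|\cdot|_{\mathbf F}$; algebraic groups over $\mathbf F$ are identified with their groups of $\mathbf F$-points. $G$ is a connected reductive group over $\mathbf F$, $\sigma$ an involution of $G$ defined over $\mathbf F$, $H$ the group of $\mathbf F$-points of an open $\mathbf F$-subgroup of the fixed point group of $\sigma$, $X=H\backslash G$ with right $G$-action and $\dot1=H\in X$. A split torus is $\sigma$-split if $\sigma(a)=a^{-1}$ for all its elements $a$. A parabolic subgroup $P$ is a $\sigma$-parabolic subgroup if $P$ and $\sigma(P)$ are opposite; then we write $P=MU$ with $M=P\cap\sigma(P)$, $U$ the unipotent radical of $P$, $U^-$ the unipotent radical of $P^-=\sigma(P)$, and $A_M$ the maximal $\sigma$-split torus of the center of $M$. A minimal $\sigma$-parabolic subgroup $P_\emptyset=M_\emptyset U_\emptyset$ is fixed, and $A_\emptyset=A_{M_\emptyset}$; a $\sigma$-parabolic subgroup is standard if it contains $P_\emptyset$. An element $a\in A_\emptyset$ is $P_\emptyset$-dominant (resp. antidominant) if $|\alpha(a)|_{\mathbf F}\ge1$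 (resp. $\le1$) for every simple root $\alpha$ of $A_\emptyset$ in the Lie algebra of $P_\emptyset$; $A_\emptyset^-$ is the set of antidominant elements. Strong $\sigma$-factorization: a compact open subgroup $J$ of $G$ has a strong $\sigma$-factorization for standard $\sigma$-parabolic subgroups if for every standard $\sigma$-parabolic $P=MU$, with $J_S=J\cap S$: (1) the product map $J_{U^-}\times J_M\times J_U\to J$ is bijective; (2) for all $a\in A_\emptyset^-$, $aJ_Ua^{-1}\subset J_U$ and $a^{-1}J_{U^-}a\subset J_{U^-}$; (3) $J=J_HJ_P$; (4) $J_M$ enjoys the same properties for $M$ and $P_\emptyset\cap M$. $X_P=X_M\times_{P^-}G$, where $X_M=\{Hg: gA_Mg^{-1}\text{ is }\sigma\text{-split}\}\subset X$ with its right $M$-action and trivial $U^-$-action; the image of $x\in X_M$ in $X_P$ is $x_P$; $\dot1_P$ has stabilizer $U^-(M\cap H)$. Measures: a $G$-invariant measure on $X$ is fixed, and $X_P$ carries the $G$-invariant measure such that for every $x\in X_M$ the well-defined bijection $xp\mapsto x_Pp$ ($p\in P$) from the open set $xP\subset X$ onto the open set $x_PP\subset X_P$ is measure preserving; $\mathrm{vol}_X$, $\mathrm{vol}_{X_P}$ denote the volumes for these measures. *)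

theory Defs
  imports "HOL-Analysis.Analysis" "HOL-Algebra.Algebraic_Closure_Type"
    "HOL-Algebra.Solvable_Groups"
begin

section \<open>Local fields\<close>

text \<open>
  The absolute value is normalized: its value group is generated by the cardinality of the
  residue field, so a uniformizer has absolute value \<open>1 / q\<close>.
\<close>

definition residue_field :: "('f::field \<Rightarrow> real) \<Rightarrow> 'f set set" where
  "residue_field v = {x. v x \<le> 1} // {(x, y). v x \<le> 1 \<and> v y \<le> 1 \<and> v (x - y) < 1}"

definition nonarch_local_field :: "('f::field \<Rightarrow> real) \<Rightarrow> bool" where
  "nonarch_local_field v \<longleftrightarrow>
     (\<forall>x. 0 \<le> v x) \<and> (\<forall>x. v x = 0 \<longleftrightarrow> x = 0) \<and>
     (\<forall>x y. v (x * y) = v x * v y) \<and>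
     (\<forall>x y. v (x + y) \<le> max (v x) (v y)) \<and>
     Metric_space.mcomplete UNIV (\<lambda>x y. v (x - y)) \<and>
     finite (residue_field v) \<and>
     v ` (UNIV - {0}) = range (\<lambda>k::int. real (card (residue_field v)) powi k)"

definition matrix_topology :: "('f::field \<Rightarrow> real) \<Rightarrow> ('f^'n^'n) topology" where
  "matrix_topology v =
     Metric_space.mtopology UNIV (\<lambda>A B. Max (range (\<lambda>(i, j). v (A $ i $ j - B $ i $ j))))"


section \<open>Linear algebraic groups\<close>

text \<open>
  A linear algebraic group is a Zariski closed subgroup of the group of invertible matrices over
  an algebraically closed field, identified with its set of points over that field.
\<close>

definition GL :: "('k::field^'n^'n) monoid" where
  "GL = \<lparr>carrier = {A. invertible A}, mult = (**), one = mat 1\<rparr>"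

inductive_set poly_functions :: "'k::field set \<Rightarrow> ('k^'n^'n \<Rightarrow> 'k) set" for R where
  const: "c \<in> R \<Longrightarrow> (\<lambda>_. c) \<in> poly_functions R"
| entry: "(\<lambda>A. A $ i $ j) \<in> poly_functions R"
| add: "f \<in> poly_functions R \<Longrightarrow> g \<in> poly_functions R \<Longrightarrow> (\<lambda>A. f A + g A) \<in> poly_functions R"
| mult: "f \<in> poly_functions R \<Longrightarrow> g \<in> poly_functions R \<Longrightarrow> (\<lambda>A. f A * g A) \<in> poly_functions R"

definition vanishing_ideal :: "'k::field set \<Rightarrow> ('k^'n^'n) set \<Rightarrow> ('k^'n^'n \<Rightarrow> 'k) set" where
  "vanishing_ideal R Z = {f \<in> poly_functions R. \<forall>A\<in>Z. f A = 0}"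

definition zariski_closed :: "('k::field^'n^'n) set \<Rightarrow> bool" where
  "zariski_closed Z \<longleftrightarrow>
     (\<exists>S \<subseteq> poly_functions UNIV. Z = {A. invertible A \<and> (\<forall>f\<in>S. f A = 0)})"

definition zariski_topology :: "('k::field^'n^'n) topology" where
  "zariski_topology =
     topology (\<lambda>V. V \<subseteq> {A. invertible A} \<and> zariski_closed ({A. invertible A} - V))"

lemma zariski_closed_Un:
  assumes "zariski_closed Y" "zariski_closed Z"
  shows "zariski_closed (Y \<union> Z)"
proof -
  from assms(1) obtain S where S: "S \<subseteq> poly_functions UNIV"
    "Y = {A. invertible A \<and> (\<forall>f\<in>S. f A = 0)}"
    unfolding zariski_closed_def by (elim exE conjE)
  from assms(2) obtain T where T: "T \<subseteq> poly_functions UNIV"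
    "Z = {A. invertible A \<and> (\<forall>f\<in>T. f A = 0)}"
    unfolding zariski_closed_def by (elim exE conjE)
  define Q where "Q = (\<Union>f\<in>S. \<Union>g\<in>T. {\<lambda>A. f A * g A})"
  have "Q \<subseteq> poly_functions UNIV"
  proof
    fix q assume "q \<in> Q"
    then obtain f g where "f \<in> S" "g \<in> T" "q = (\<lambda>A. f A * g A)"
      unfolding Q_def by (elim UN_E singletonE)
    then show "q \<in> poly_functions UNIV"
      using poly_functions.mult[of f UNIV g] S(1) T(1) by (simp add: subset_iff)
  qed
  moreover have "A \<in> Y \<union> Z \<longleftrightarrow> invertible A \<and> (\<forall>q\<in>Q. q A = 0)" for A
  proof -
    have "(\<forall>q\<in>Q. q A = 0) \<longleftrightarrow> (\<forall>f\<in>S. f A = 0) \<or> (\<forall>g\<in>T. g A = 0)"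
      unfolding Q_def ball_UN by simp
    then show ?thesis unfolding S(2) T(2) Un_iff mem_Collect_eq by argo
  qed
  then have "Y \<union> Z = {A. invertible A \<and> (\<forall>q\<in>Q. q A = 0)}"
    by (intro Set.set_eqI) (simp only: mem_Collect_eq)
  ultimately show ?thesis
    unfolding zariski_closed_def by (intro exI[of _ Q] conjI)
qed

lemma zariski_closed_Inter:
  assumes "\<And>Z. Z \<in> \<Z> \<Longrightarrow> zariski_closed Z"
  shows "zariski_closed ({A. invertible A} \<inter> \<Inter>\<Z>)"
proof -
  have "\<forall>Z\<in>\<Z>. \<exists>S. S \<subseteq> poly_functions UNIV \<and> Z = {A. invertible A \<and> (\<forall>f\<in>S. f A = 0)}"
    using assms unfolding zariski_closed_def by (intro ballI)
  then obtain S where S: "\<forall>Z\<in>\<Z>. S Z \<subseteq> poly_functions UNIV \<and>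
      Z = {A. invertible A \<and> (\<forall>f\<in>S Z. f A = 0)}"
    by (elim bchoice[THEN exE])
  have mem: "A \<in> Z \<longleftrightarrow> invertible A \<and> (\<forall>f\<in>S Z. f A = 0)" if "Z \<in> \<Z>" for A Z
  proof -
    have "Z = {A. invertible A \<and> (\<forall>f\<in>S Z. f A = 0)}" using S that by (elim ballE conjE) auto
    from eqset_imp_iff[OF this, of A] show ?thesis by (simp only: mem_Collect_eq)
  qed
  have "A \<in> {A. invertible A} \<inter> \<Inter>\<Z> \<longleftrightarrow> invertible A \<and> (\<forall>f\<in>(\<Union>Z\<in>\<Z>. S Z). f A = 0)" for A
    unfolding Int_iff Inter_iff ball_UN mem_Collect_eq using mem[of _ A] by blast
  then have "{A. invertible A} \<inter> \<Inter>\<Z> = {A. invertible A \<and> (\<forall>f\<in>(\<Union>Z\<in>\<Z>. S Z). f A = 0)}"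
    by (intro Set.set_eqI) (simp only: mem_Collect_eq)
  moreover have "(\<Union>Z\<in>\<Z>. S Z) \<subseteq> poly_functions UNIV"
    by (intro UN_least) (rule conjunct1[OF bspec[OF S]])
  ultimately show ?thesis
    unfolding zariski_closed_def by (intro exI[of _ "\<Union>Z\<in>\<Z>. S Z"] conjI)
qed

lemma istopology_zariski:
  "istopology (\<lambda>V. V \<subseteq> {A. invertible A} \<and> zariski_closed ({A. invertible A} - V))"
  unfolding istopology_def
proof (intro conjI allI impI)
  fix V W :: "('a^'b^'b) set"
  assume V: "V \<subseteq> {A. invertible A} \<and> zariski_closed ({A. invertible A} - V)"
    and W: "W \<subseteq> {A. invertible A} \<and> zariski_closed ({A. invertible A} - W)"
  show "zariski_closed ({A. invertible A} - V \<inter> W)"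
    unfolding Diff_Int using zariski_closed_Un[OF conjunct2[OF V] conjunct2[OF W]] .
  show "V \<inter> W \<subseteq> {A. invertible A}" using V by (intro le_infI1) (elim conjE)
next
  fix \<K> :: "('a^'b^'b) set set"
  assume K: "\<forall>V\<in>\<K>. V \<subseteq> {A. invertible A} \<and> zariski_closed ({A. invertible A} - V)"
  have "zariski_closed ({A. invertible A} \<inter> \<Inter>((\<lambda>V. {A. invertible A} - V) ` \<K>))"
    using K by (intro zariski_closed_Inter) (elim imageE, simp)
  moreover have "{A. invertible A} \<inter> \<Inter>((\<lambda>V. {A. invertible A} - V) ` \<K>) =
      {A :: 'a^'b^'b. invertible A} - \<Union>\<K>"
    by (intro Set.set_eqI) (simp only: Int_iff Diff_iff Union_iff INT_iff, blast)
  ultimately show "zariski_closed ({A. invertible A} - \<Union>\<K>)" by simp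
  show "\<Union>\<K> \<subseteq> {A. invertible A}" by (intro Union_least) (rule conjunct1[OF bspec[OF K]])
qed

definition algebraic_group :: "('k::field^'n^'n) set \<Rightarrow> bool" where
  "algebraic_group G \<longleftrightarrow> subgroup G GL \<and> zariski_closed G"

definition unipotent_group :: "('k::field^'n^'n) set \<Rightarrow> bool" where
  "unipotent_group N \<longleftrightarrow>
     algebraic_group N \<and> (\<forall>A\<in>N. \<exists>m. (((**) (A - mat 1)) ^^ m) (mat 1) = 0)"

text \<open>
  The connected normal unipotent closed subgroups of \<open>G\<close> have a largest element, which is
  therefore their union.
\<close>

definition unipotent_radical :: "('k::field^'n^'n) set \<Rightarrow> ('k^'n^'n) set" where
  "unipotent_radical G =
     \<Union>{N. unipotent_group N \<and> connectedin zariski_topology N \<and> N \<lhd> GL\<lparr>carrier := G\<rparr>}"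

definition connected_reductive :: "('k::field^'n^'n) set \<Rightarrow> bool" where
  "connected_reductive G \<longleftrightarrow>
     algebraic_group G \<and> connectedin zariski_topology G \<and> unipotent_radical G = {mat 1}"

definition connected_solvable_subgroup :: "('k::field^'n^'n) set \<Rightarrow> ('k^'n^'n) set \<Rightarrow> bool" where
  "connected_solvable_subgroup G B \<longleftrightarrow>
     algebraic_group B \<and> B \<subseteq> G \<and> connectedin zariski_topology B \<and>
     solvable (GL\<lparr>carrier := B\<rparr>)"

definition borel_subgroup :: "('k::field^'n^'n) set \<Rightarrow> ('k^'n^'n) set \<Rightarrow> bool" where
  "borel_subgroup G B \<longleftrightarrow>
     connected_solvable_subgroup G B \<and>
     (\<forall>B'. connected_solvable_subgroup G B' \<and> B \<subseteq> B' \<longrightarrow> B' = B)"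

definition parabolic_subgroup :: "('k::field^'n^'n) set \<Rightarrow> ('k^'n^'n) set \<Rightarrow> bool" where
  "parabolic_subgroup G P \<longleftrightarrow>
     algebraic_group P \<and> P \<subseteq> G \<and> (\<exists>B. borel_subgroup G B \<and> B \<subseteq> P)"

definition levi_subgroup :: "('k::field^'n^'n) set \<Rightarrow> ('k^'n^'n) set \<Rightarrow> bool" where
  "levi_subgroup P M \<longleftrightarrow>
     algebraic_group M \<and> M \<subseteq> P \<and>
     M <#>\<^bsub>GL\<^esub> unipotent_radical P = P \<and> M \<inter> unipotent_radical P = {mat 1}"

definition opposite :: "('k::field^'n^'n) set \<Rightarrow> ('k^'n^'n) set \<Rightarrow> bool" where
  "opposite P Q \<longleftrightarrow> levi_subgroup P (P \<inter> Q) \<and> levi_subgroup Q (P \<inter> Q)"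

definition center :: "('k::field^'n^'n) set \<Rightarrow> ('k^'n^'n) set" where
  "center M = {z \<in> M. \<forall>m\<in>M. z ** m = m ** z}"

text \<open>
  The Lie algebra is the tangent space at the identity: the coefficient of \<open>t\<close> in
  \<open>f (1 + t Y)\<close> is the derivative of \<open>f\<close> at the identity in direction \<open>Y\<close>. Over an infinite
  field the polynomial \<open>p\<close> below exists and is unique.
\<close>

definition lie_algebra :: "('k::field^'n^'n) set \<Rightarrow> ('k^'n^'n) set" where
  "lie_algebra G = {Y. \<forall>f \<in> vanishing_ideal UNIV G.
     \<forall>p. (\<forall>t. poly p t = f (mat 1 + map_matrix ((*) t) Y)) \<longrightarrow> Polynomial.coeff p 1 = 0}"


section \<open>Groups over a field\<close>

text \<open>
  A group over the field \<open>'f\<close> is an algebraic group over \<open>'f alg_closure\<close> whose ideal is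
  spanned by polynomials with coefficients in \<open>'f\<close>. Over imperfect fields this is stronger than
  being the zero set of polynomials with coefficients in \<open>'f\<close>.
\<close>

definition F_points :: "('f::field alg_closure^'n^'n) set \<Rightarrow> ('f^'n^'n) set" where
  "F_points Z = {A. map_matrix to_ac A \<in> Z}"

definition defined_over_F :: "('f::field alg_closure^'n^'n) set \<Rightarrow> bool" where
  "defined_over_F Z \<longleftrightarrow>
     (\<forall>f \<in> vanishing_ideal UNIV Z. \<exists>I c. finite I \<and> I \<subseteq> vanishing_ideal (range to_ac) Z \<and>
        f = (\<lambda>A. \<Sum>h\<in>I. c h * h A))"

definition F_group :: "('f::field alg_closure^'n^'n) set \<Rightarrow> bool" where
  "F_group G \<longleftrightarrow> algebraic_group G \<and> defined_over_F G"

definition F_regular_on ::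
    "('f::field alg_closure^'n^'n) set \<Rightarrow> ('f alg_closure^'n^'n \<Rightarrow> 'f alg_closure^'n^'n) \<Rightarrow> bool"
  where
  "F_regular_on Z \<phi> \<longleftrightarrow>
     (\<forall>i j. \<exists>p \<in> poly_functions (range to_ac). \<exists>m. \<forall>A\<in>Z. \<phi> A $ i $ j = p A / det A ^ m)"

definition F_isomorphism ::
    "('f::field alg_closure^'n^'n) set \<Rightarrow> ('f alg_closure^'n^'n) set \<Rightarrow>
     ('f alg_closure^'n^'n \<Rightarrow> 'f alg_closure^'n^'n) \<Rightarrow> bool" where
  "F_isomorphism G G' \<phi> \<longleftrightarrow>
     \<phi> \<in> iso (GL\<lparr>carrier := G\<rparr>) (GL\<lparr>carrier := G'\<rparr>) \<and>
     F_regular_on G \<phi> \<and> F_regular_on G' (inv_into G \<phi>)"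

text \<open>
  \<open>diagonal_torus S\<close> is the power of the multiplicative group indexed by \<open>S\<close>. The rank of
  a split torus in the \<open>n\<close> by \<open>n\<close> matrices is at most \<open>n\<close>, so these powers suffice.
\<close>

definition diagonal_torus :: "'n::finite set \<Rightarrow> ('k::field^'n^'n) set" where
  "diagonal_torus S =
     {A. (\<forall>i j. i \<noteq> j \<longrightarrow> A $ i $ j = 0) \<and> (\<forall>i. A $ i $ i \<noteq> 0) \<and> (\<forall>i. i \<notin> S \<longrightarrow> A $ i $ i = 1)}"

definition split_torus :: "('f::field alg_closure^'n^'n) set \<Rightarrow> bool" where
  "split_torus T \<longleftrightarrow> F_group T \<and> (\<exists>S \<phi>. F_isomorphism (diagonal_torus S) T \<phi>)"

text \<open>
  For a split torus \<open>A\<close> over an infinite field, the rational points of \<open>A\<close> are dense in \<open>A\<close>, so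
  the roots of \<open>A\<close> in the Lie algebra of \<open>P\<close> are determined by their values on rational points.
\<close>

definition roots ::
    "('f::field alg_closure^'n^'n) set \<Rightarrow> ('f alg_closure^'n^'n) set \<Rightarrow> ('f^'n^'n \<Rightarrow> 'f) set" where
  "roots A P = {\<alpha> \<in> extensional (F_points A). (\<exists>a \<in> F_points A. \<alpha> a \<noteq> 1) \<and>
     (\<exists>Y \<in> F_points (lie_algebra P). Y \<noteq> 0 \<and>
        (\<forall>a \<in> F_points A. a ** Y ** matrix_inv a = map_matrix ((*) (\<alpha> a)) Y))}"

definition simple_roots ::
    "('f::field alg_closure^'n^'n) set \<Rightarrow> ('f alg_closure^'n^'n) set \<Rightarrow> ('f^'n^'n \<Rightarrow> 'f) set" where
  "simple_roots A P = {\<alpha> \<in> roots A P.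
     \<not> (\<exists>\<beta> \<in> roots A P. \<exists>\<gamma> \<in> roots A P. \<forall>a \<in> F_points A. \<alpha> a = \<beta> a * \<gamma> a)}"

definition dominant ::
    "('f::field \<Rightarrow> real) \<Rightarrow> ('f alg_closure^'n^'n) set \<Rightarrow> ('f alg_closure^'n^'n) set \<Rightarrow>
     ('f^'n^'n) set" where
  "dominant v A P = {a \<in> F_points A. \<forall>\<alpha> \<in> simple_roots A P. v (\<alpha> a) \<ge> 1}"

definition antidominant ::
    "('f::field \<Rightarrow> real) \<Rightarrow> ('f alg_closure^'n^'n) set \<Rightarrow> ('f alg_closure^'n^'n) set \<Rightarrow>
     ('f^'n^'n) set" where
  "antidominant v A P = {a \<in> F_points A. \<forall>\<alpha> \<in> simple_roots A P. v (\<alpha> a) \<le> 1}"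


section \<open>Involutions\<close>

definition F_involution ::
    "('f::field alg_closure^'n^'n) set \<Rightarrow> ('f alg_closure^'n^'n \<Rightarrow> 'f alg_closure^'n^'n) \<Rightarrow> bool"
  where
  "F_involution G \<sigma> \<longleftrightarrow>
     \<sigma> \<in> iso (GL\<lparr>carrier := G\<rparr>) (GL\<lparr>carrier := G\<rparr>) \<and> F_regular_on G \<sigma> \<and> (\<forall>g\<in>G. \<sigma> (\<sigma> g) = g)"

definition fixed_points :: "('a \<Rightarrow> 'a) \<Rightarrow> 'a set \<Rightarrow> 'a set" where
  "fixed_points \<sigma> G = {g \<in> G. \<sigma> g = g}"

definition open_F_subgroup ::
    "('f::field alg_closure^'n^'n) set \<Rightarrow> ('f alg_closure^'n^'n) set \<Rightarrow> bool" where
  "open_F_subgroup G H \<longleftrightarrow> F_group H \<and> openin (subtopology zariski_topology G) H"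

definition sigma_split :: "('k::field^'n^'n \<Rightarrow> 'k^'n^'n) \<Rightarrow> ('k^'n^'n) set \<Rightarrow> bool" where
  "sigma_split \<sigma> A \<longleftrightarrow> (\<forall>a\<in>A. \<sigma> a = matrix_inv a)"

definition sigma_split_torus ::
    "('f::field alg_closure^'n^'n \<Rightarrow> 'f alg_closure^'n^'n) \<Rightarrow> ('f alg_closure^'n^'n) set \<Rightarrow> bool"
  where
  "sigma_split_torus \<sigma> A \<longleftrightarrow> split_torus A \<and> sigma_split \<sigma> A"

definition maximal_sigma_split_torus ::
    "('f::field alg_closure^'n^'n \<Rightarrow> 'f alg_closure^'n^'n) \<Rightarrow> ('f alg_closure^'n^'n) set \<Rightarrow>
     ('f alg_closure^'n^'n) set \<Rightarrow> bool" where
  "maximal_sigma_split_torus \<sigma> Z A \<longleftrightarrow>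
     sigma_split_torus \<sigma> A \<and> A \<subseteq> Z \<and>
     (\<forall>A'. sigma_split_torus \<sigma> A' \<and> A' \<subseteq> Z \<and> A \<subseteq> A' \<longrightarrow> A' = A)"

definition sigma_parabolic ::
    "('f::field alg_closure^'n^'n \<Rightarrow> 'f alg_closure^'n^'n) \<Rightarrow> ('f alg_closure^'n^'n) set \<Rightarrow>
     ('f alg_closure^'n^'n) set \<Rightarrow> bool" where
  "sigma_parabolic \<sigma> G P \<longleftrightarrow> F_group P \<and> parabolic_subgroup G P \<and> opposite P (\<sigma> ` P)"

definition minimal_sigma_parabolic ::
    "('f::field alg_closure^'n^'n \<Rightarrow> 'f alg_closure^'n^'n) \<Rightarrow> ('f alg_closure^'n^'n) set \<Rightarrow>
     ('f alg_closure^'n^'n) set \<Rightarrow> bool" where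
  "minimal_sigma_parabolic \<sigma> G P \<longleftrightarrow>
     sigma_parabolic \<sigma> G P \<and> (\<forall>Q. sigma_parabolic \<sigma> G Q \<and> Q \<subseteq> P \<longrightarrow> Q = P)"

definition standard_sigma_parabolic ::
    "('f::field alg_closure^'n^'n \<Rightarrow> 'f alg_closure^'n^'n) \<Rightarrow> ('f alg_closure^'n^'n) set \<Rightarrow>
     ('f alg_closure^'n^'n) set \<Rightarrow> ('f alg_closure^'n^'n) set \<Rightarrow> bool" where
  "standard_sigma_parabolic \<sigma> G P\<^sub>0 P \<longleftrightarrow> sigma_parabolic \<sigma> G P \<and> P\<^sub>0 \<subseteq> P"

text \<open>For a \<open>\<sigma>\<close>-parabolic \<open>P = M U\<close>: the Levi subgroup \<open>M\<close>, and the opposite radical \<open>U\<^sup>-\<close>.\<close>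

definition levi :: "('k::field^'n^'n \<Rightarrow> 'k^'n^'n) \<Rightarrow> ('k^'n^'n) set \<Rightarrow> ('k^'n^'n) set" where
  "levi \<sigma> P = P \<inter> \<sigma> ` P"

definition opp_radical :: "('k::field^'n^'n \<Rightarrow> 'k^'n^'n) \<Rightarrow> ('k^'n^'n) set \<Rightarrow> ('k^'n^'n) set" where
  "opp_radical \<sigma> P = unipotent_radical (\<sigma> ` P)"

definition compact_open_subgroup ::
    "('f::field \<Rightarrow> real) \<Rightarrow> ('f alg_closure^'n^'n) set \<Rightarrow> ('f^'n^'n) set \<Rightarrow> bool" where
  "compact_open_subgroup v G J \<longleftrightarrow>
     subgroup J (GL\<lparr>carrier := F_points G\<rparr>) \<and>
     compactin (subtopology (matrix_topology v) (F_points G)) J \<and>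
     openin (subtopology (matrix_topology v) (F_points G)) J"

text \<open>
  The condition on \<open>J \<inter> M\<close> is circular for the standard parabolic \<open>P = G\<close>, where \<open>M = G\<close>; hence
  the coinductive definition. For \<open>P \<noteq> G\<close> the group \<open>M\<close> has smaller dimension, so this amounts to
  imposing the first three conditions on \<open>G\<close> and on all successive proper Levi subgroups.
  The group \<open>M\<close> has the same minimal Levi subgroup as \<open>G\<close>, hence the same torus \<open>A\<^sub>0\<close>, but the
  antidominance condition becomes the one for \<open>P\<^sub>0 \<inter> M\<close>.
\<close>

coinductive strong_factorization ::
    "('f::field \<Rightarrow> real) \<Rightarrow> ('f alg_closure^'n^'n \<Rightarrow> 'f alg_closure^'n^'n) \<Rightarrow>
     ('f alg_closure^'n^'n) set \<Rightarrow> ('f alg_closure^'n^'n) set \<Rightarrow>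
     ('f alg_closure^'n^'n) set \<Rightarrow> ('f alg_closure^'n^'n) set \<Rightarrow> ('f^'n^'n) set \<Rightarrow> bool"
  for v \<sigma> H A\<^sub>0 where
  "strong_factorization v \<sigma> H A\<^sub>0 G P\<^sub>0 J"
  if "\<forall>P. standard_sigma_parabolic \<sigma> G P\<^sub>0 P \<longrightarrow>
        bij_betw (\<lambda>(x, y, z). x ** y ** z)
          ((J \<inter> F_points (opp_radical \<sigma> P)) \<times> (J \<inter> F_points (levi \<sigma> P)) \<times>
           (J \<inter> F_points (unipotent_radical P))) J \<and>
        (\<forall>a \<in> antidominant v A\<^sub>0 P\<^sub>0.
          (\<lambda>x. a ** x ** matrix_inv a) ` (J \<inter> F_points (unipotent_radical P))
            \<subseteq> J \<inter> F_points (unipotent_radical P) \<and>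
          (\<lambda>x. matrix_inv a ** x ** a) ` (J \<inter> F_points (opp_radical \<sigma> P))
            \<subseteq> J \<inter> F_points (opp_radical \<sigma> P)) \<and>
        J = (J \<inter> F_points H) <#>\<^bsub>GL\<^esub> (J \<inter> F_points P) \<and>
        strong_factorization v \<sigma> H A\<^sub>0 (levi \<sigma> P) (P\<^sub>0 \<inter> levi \<sigma> P) (J \<inter> F_points (levi \<sigma> P))"


section \<open>The spaces \<open>X\<close> and \<open>X\<^sub>P\<close>\<close>

definition quotient_topology :: "'a topology \<Rightarrow> 'a set set \<Rightarrow> 'a set topology" where
  "quotient_topology T \<Q> = topology (\<lambda>\<U>. \<U> \<subseteq> \<Q> \<and> openin T (\<Union>\<U>))"

lemma istopology_quotient:
  assumes "disjoint \<Q>"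
  shows "istopology (\<lambda>\<U>. \<U> \<subseteq> \<Q> \<and> openin T (\<Union>\<U>))"
  unfolding istopology_def
proof (intro conjI allI impI)
  fix \<U> \<V> assume U: "\<U> \<subseteq> \<Q> \<and> openin T (\<Union>\<U>)" and V: "\<V> \<subseteq> \<Q> \<and> openin T (\<Union>\<V>)"
  have "B = C" if "B \<in> \<U>" "C \<in> \<V>" "x \<in> B" "x \<in> C" for B C x
    using disjointD[OF assms, of B C] that U V by (meson disjoint_iff subsetD)
  then have "\<Union>(\<U> \<inter> \<V>) = \<Union>\<U> \<inter> \<Union>\<V>" by fast
  then show "openin T (\<Union>(\<U> \<inter> \<V>))" using U V by (simp add: openin_Int)
  show "\<U> \<inter> \<V> \<subseteq> \<Q>" using conjunct1[OF U] by (rule le_infI1)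
next
  fix \<K> assume K: "\<forall>\<U>\<in>\<K>. \<U> \<subseteq> \<Q> \<and> openin T (\<Union>\<U>)"
  have "\<Union>(\<Union>\<K>) = \<Union>((\<Union>) ` \<K>)" by fast
  moreover have "openin T (\<Union>((\<Union>) ` \<K>))"
    using K by (intro openin_Union) (elim imageE, simp)
  ultimately show "openin T (\<Union>(\<Union>\<K>))" by simp
  show "\<Union>\<K> \<subseteq> \<Q>" by (intro Union_least) (rule conjunct1[OF bspec[OF K]])
qed

definition X_topology ::
    "('f::field \<Rightarrow> real) \<Rightarrow> ('f alg_closure^'n^'n) set \<Rightarrow> ('f alg_closure^'n^'n) set \<Rightarrow>
     ('f^'n^'n) set topology" where
  "X_topology v G H =
     quotient_topology (subtopology (matrix_topology v) (F_points G))
       (rcosets\<^bsub>GL\<lparr>carrier := F_points G\<rparr>\<^esub> F_points H)"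

definition X_act :: "('f::field^'n^'n) set \<Rightarrow> 'f^'n^'n \<Rightarrow> ('f^'n^'n) set" where
  "X_act x g = x #>\<^bsub>GL\<^esub> g"

definition X_M ::
    "('f::field alg_closure^'n^'n \<Rightarrow> 'f alg_closure^'n^'n) \<Rightarrow> ('f alg_closure^'n^'n) set \<Rightarrow>
     ('f alg_closure^'n^'n) set \<Rightarrow> ('f alg_closure^'n^'n) set \<Rightarrow> ('f^'n^'n) set set" where
  "X_M \<sigma> G H A =
     {X_act (F_points H) g | g. g \<in> F_points G \<and>
        sigma_split \<sigma> ((\<lambda>a. map_matrix to_ac g ** a ** matrix_inv (map_matrix to_ac g)) ` A)}"

text \<open>
  \<open>X\<^sub>P\<close> is the set of classes of pairs \<open>(x, g)\<close> modulo \<open>(x p, g) \<sim> (x, p g)\<close> for \<open>p\<close> in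
  \<open>P\<^sup>- = M U\<^sup>-\<close>, which acts on \<open>x\<close> through \<open>M\<close>.
\<close>

definition X_P_rel ::
    "('f::field alg_closure^'n^'n \<Rightarrow> 'f alg_closure^'n^'n) \<Rightarrow> ('f alg_closure^'n^'n) set \<Rightarrow>
     ('f alg_closure^'n^'n) set \<Rightarrow> ('f alg_closure^'n^'n) set \<Rightarrow> ('f alg_closure^'n^'n) set \<Rightarrow>
     ((('f^'n^'n) set \<times> ('f^'n^'n)) \<times> (('f^'n^'n) set \<times> ('f^'n^'n))) set" where
  "X_P_rel \<sigma> G H P A =
     {((X_act x m, g), (x, m ** u ** g)) | x m u g.
        x \<in> X_M \<sigma> G H A \<and> m \<in> F_points (levi \<sigma> P) \<and> u \<in> F_points (opp_radical \<sigma> P) \<and>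
        g \<in> F_points G}"

definition X_P_topology ::
    "('f::field \<Rightarrow> real) \<Rightarrow> ('f alg_closure^'n^'n \<Rightarrow> 'f alg_closure^'n^'n) \<Rightarrow>
     ('f alg_closure^'n^'n) set \<Rightarrow> ('f alg_closure^'n^'n) set \<Rightarrow>
     ('f alg_closure^'n^'n) set \<Rightarrow> ('f alg_closure^'n^'n) set \<Rightarrow>
     (('f^'n^'n) set \<times> ('f^'n^'n)) set topology" where
  "X_P_topology v \<sigma> G H P A =
     quotient_topology
       (prod_topology (subtopology (X_topology v G H) (X_M \<sigma> G H A))
          (subtopology (matrix_topology v) (F_points G)))
       ((X_M \<sigma> G H A \<times> F_points G) // X_P_rel \<sigma> G H P A)"

definition X_P_act ::
    "(('f::field^'n^'n) set \<times> ('f^'n^'n)) set \<Rightarrow> 'f^'n^'n \<Rightarrow>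
     (('f^'n^'n) set \<times> ('f^'n^'n)) set" where
  "X_P_act c h = (\<lambda>(x, g). (x, g ** h)) ` c"

definition X_P_point ::
    "('f::field alg_closure^'n^'n \<Rightarrow> 'f alg_closure^'n^'n) \<Rightarrow> ('f alg_closure^'n^'n) set \<Rightarrow>
     ('f alg_closure^'n^'n) set \<Rightarrow> ('f alg_closure^'n^'n) set \<Rightarrow> ('f alg_closure^'n^'n) set \<Rightarrow>
     ('f^'n^'n) set \<Rightarrow> (('f^'n^'n) set \<times> ('f^'n^'n)) set" where
  "X_P_point \<sigma> G H P A x = X_P_rel \<sigma> G H P A `` {(x, mat 1)}"

definition invariant_measure ::
    "'a topology \<Rightarrow> ('a \<Rightarrow> 'g \<Rightarrow> 'a) \<Rightarrow> 'g set \<Rightarrow> 'a measure \<Rightarrow> bool" where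
  "invariant_measure T act \<Gamma> \<mu> \<longleftrightarrow>
     space \<mu> = topspace T \<and> sets \<mu> = sigma_sets (topspace T) {U. openin T U} \<and>
     emeasure \<mu> (space \<mu>) \<noteq> 0 \<and> (\<forall>C. compactin T C \<longrightarrow> emeasure \<mu> C < \<infinity>) \<and>
     (\<forall>g\<in>\<Gamma>. \<forall>B\<in>sets \<mu>. emeasure \<mu> ((\<lambda>x. act x g) ` B) = emeasure \<mu> B)"

definition compatible_measures ::
    "('f::field alg_closure^'n^'n \<Rightarrow> 'f alg_closure^'n^'n) \<Rightarrow> ('f alg_closure^'n^'n) set \<Rightarrow>
     ('f alg_closure^'n^'n) set \<Rightarrow> ('f alg_closure^'n^'n) set \<Rightarrow> ('f alg_closure^'n^'n) set \<Rightarrow>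
     ('f^'n^'n) set measure \<Rightarrow> (('f^'n^'n) set \<times> ('f^'n^'n)) set measure \<Rightarrow> bool" where
  "compatible_measures \<sigma> G H P A \<mu> \<nu> \<longleftrightarrow>
     (\<forall>x \<in> X_M \<sigma> G H A. \<exists>f.
        (\<forall>p \<in> F_points P. f (X_act x p) = X_P_act (X_P_point \<sigma> G H P A x) p) \<and>
        bij_betw f (X_act x ` F_points P) (X_P_act (X_P_point \<sigma> G H P A x) ` F_points P) \<and>
        (\<forall>B \<subseteq> X_act x ` F_points P. (B \<in> sets \<mu> \<longleftrightarrow> f ` B \<in> sets \<nu>) \<and>
           (B \<in> sets \<mu> \<longrightarrow> emeasure \<nu> (f ` B) = emeasure \<mu> B)))"

end

theory Submission
  imports Defs
begin

text \<open>
  Let \<open>a\<close> be dominant, so that conjugation by \<open>a\<close> contracts the opposite unipotent parts of \<open>K\<close>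
  while conjugation by its inverse contracts the unipotent parts.

  For the minimal \<open>\<sigma>\<close>-parabolic \<open>P\<^sub>0\<close> the element \<open>a\<close> centralizes the Levi subgroup. Factor \<open>k\<close>
  in \<open>K\<close> into its opposite, Levi and unipotent components. Conjugation by \<open>a\<close> moves the opposite
  component to the left of \<open>a\<close>, where it stays in \<open>K\<close>; there it is a product of an element of
  \<open>K \<inter> H\<close>, which \<open>H\<close> absorbs, and an element of \<open>K \<inter> P\<^sub>0\<close>, which can be moved back to the right
  of \<open>a\<close>. Thus \<open>H a K\<close> equals \<open>H a (K \<inter> P\<^sub>0)\<close> (\<open>dominant_double_coset\<close>). For a standard
  \<open>P = M U\<close> the set \<open>H a (K \<inter> P)\<close> lies between \<open>H a (K \<inter> P\<^sub>0)\<close> and \<open>H a K\<close>, and \<open>K \<inter> P\<close> is the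
  product of \<open>K \<inter> M\<close> and \<open>K \<inter> U\<close>. This is the first assertion.

  The second assertion compares two orbits. By the above, the orbit of the base point of \<open>X\<close>
  under \<open>a K\<close> is its orbit under \<open>a (K \<inter> P)\<close>. The same holds for the base point of \<open>X\<^sub>P\<close>, for a
  simpler reason: the opposite component of an element of \<open>K\<close>, conjugated by \<open>a\<close>, lies in the
  opposite unipotent radical, which fixes that point (\<open>X_P_point_opp_radical\<close>). The measure
  preserving bijection between the orbits of \<open>P\<close> takes one set to the other.

  The opposite unipotent radical fixes the base point because it is a group, although it is
  defined as the union of all connected normal unipotent closed subgroups. Most of the text
  proves this (\<open>subgroup_unipotent_radical\<close>): two such subgroups lie in a third one, the Zariski
  closure of their product (\<open>unipotent_normal_subgroups_directed\<close>). Its unipotence rests on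
  Kolchin's theorem (\<open>kolchin\<close>), that for a group of unipotent matrices all sufficiently long
  products of differences \<open>x - 1\<close> vanish. The remaining point is that the group \<open>\<sigma> P\<close>, whose
  radical is taken, is again Zariski closed (\<open>algebraic_group_involution_image\<close>).
\<close>


section \<open>Nilpotent matrices and invariant subspaces\<close>

lemma matrix_add_rdistrib: "(A + B) ** C = A ** C + B ** (C :: 'k::semiring_1^'p^'n)"
  by (vector matrix_matrix_mult_def sum.distrib[symmetric] distrib_right)

lemma mat_matrix_mult_vector: "(mat c ** A) *v w = c *s (A *v (w :: 'k::field^'n))"
proof -
  have "mat c *v u = c *s u" for u :: "'k^'m"
    by (simp add: vec_eq_iff matrix_vector_mult_def mat_def if_distrib[of "\<lambda>x. x * _"] cong: if_cong)
  then show ?thesis by (simp add: matrix_vector_mul_assoc[symmetric])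
qed

lemma matrix_mat_commute: "A ** mat c = mat c ** (A :: 'k::field^'n^'n)"
  by (simp add: vec_eq_iff matrix_matrix_mult_def mat_def if_distrib[of "\<lambda>x. x * _"]
      if_distrib[of "\<lambda>x. _ * x"] mult.commute cong: if_cong)

text \<open>
  Multiplication by the scalar matrix \<open>mat c\<close> serves as scalar multiplication of matrices. This
  makes linear combinations of matrices available through the span of a vector space.
\<close>

interpretation matrix_space: vector_space "\<lambda>(c::'k::field) (A::'k^'n^'n). mat c ** A"
proof
  fix a b :: 'k and x y :: "'k^'n^'n"
  show "mat a ** (x + y) = mat a ** x + mat a ** y" by (rule matrix_add_ldistrib)
  show "mat (a + b) ** x = mat a ** x + mat b ** x"
    by (simp add: matrix_eq mat_matrix_mult_vector matrix_vector_mult_add_rdistrib vec.scale_left_distrib)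
  show "mat a ** (mat b ** x) = mat (a * b) ** x"
    by (simp add: matrix_eq mat_matrix_mult_vector)
  show "mat 1 ** x = x" by simp
qed

lemma matrix_funpow_mult:
  fixes Z A B :: "'k::field^'n^'n"
  shows "(((**) Z) ^^ m) A ** B = (((**) Z) ^^ m) (A ** B)"
  by (induction m) (simp_all add: matrix_mul_assoc[symmetric])

lemma matrix_funpow_vector:
  fixes Z A :: "'k::field^'n^'n"
  shows "(((**) Z) ^^ m) A *v w = (((*v) Z) ^^ m) (A *v w)"
  by (induction m) (simp_all add: matrix_vector_mul_assoc[symmetric])

lemma matrix_funpow_eq_0_iff:
  fixes Z :: "'k::field^'n^'n"
  shows "(((**) Z) ^^ m) (mat 1) = 0 \<longleftrightarrow> (\<forall>w. (((*v) Z) ^^ m) w = 0)"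
  by (simp add: matrix_eq matrix_funpow_vector)

lemma matrix_generalized_inverse: "\<exists>S :: 'k::field^'n^'n. Z ** S ** Z = Z"
proof -
  obtain g where g: "Vector_Spaces.linear (*s) (*s) g" "\<forall>w\<in>range ((*v) Z). Z *v g w = w"
    using vec.linear_exists_right_inverse_on[of "(*v) Z" UNIV] by auto
  have "Z ** matrix g ** Z = Z"
    using g(2) by (simp add: matrix_eq matrix_vector_mul_assoc[symmetric] matrix_works[OF g(1)])
  then show ?thesis ..
qed

text \<open>
  If \<open>Z S Z = Z\<close>, then cyclicity of the trace moves the factor \<open>Z S\<close> to the right, so that \<open>Z\<close>
  and \<open>Z Z S\<close> have the same trace; but the powers of \<open>Z Z S\<close> are \<open>Z ^ (j + 1) S\<close>, so they vanish
  one step earlier than those of \<open>Z\<close>.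
\<close>

lemma trace_nilpotent_matrix:
  fixes Z :: "'k::field^'n^'n"
  assumes "(((**) Z) ^^ m) Z = 0"
  shows "trace Z = 0"
  using assms
proof (induction m arbitrary: Z)
  case 0
  then show ?case by (simp add: trace_def)
next
  case (Suc m)
  obtain S where S: "Z ** S ** Z = Z" using matrix_generalized_inverse by blast
  define Y where "Y = Z ** (Z ** S)"
  have "(((**) Y) ^^ j) Y = (((**) Z) ^^ Suc j) (Z ** S)" for j
  proof (induction j)
    case (Suc j)
    have "(((**) Y) ^^ Suc j) Y = Z ** (Z ** S ** Z) ** ((((**) Z) ^^ j) (Z ** S))"
      using Suc by (simp add: Y_def matrix_mul_assoc)
    also have "\<dots> = (((**) Z) ^^ Suc (Suc j)) (Z ** S)"
      by (simp only: S) (simp add: matrix_mul_assoc)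
    finally show ?case .
  qed (simp add: Y_def)
  then have "(((**) Y) ^^ m) Y = 0"
    using Suc.prems matrix_funpow_mult[of "Suc m" Z Z S] by simp
  then have "trace Y = 0" by (rule Suc.IH)
  moreover have "trace Z = trace Y"
    using trace_mul_sym[of "Z ** S" Z] S by (simp add: Y_def)
  ultimately show ?case by simp
qed

lemma linear_projection_exists:
  fixes V :: "('k::field^'n) set"
  assumes "vec.subspace V"
  shows "\<exists>q :: 'k^'n^'n. (\<forall>w. q *v w \<in> V) \<and> (\<forall>w\<in>V. q *v w = w)"
proof -
  obtain g where g: "g ` UNIV \<subseteq> V" "Vector_Spaces.linear (*s) (*s) g" "\<forall>w\<in>V. g (w :: 'k^'n) = w"
    using vec.linear_exists_left_inverse_on[of "\<lambda>w. w" V] assms vec.linear_ident by auto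
  then show ?thesis by (intro exI[of _ "matrix g"]) (auto simp: matrix_works)
qed

text \<open>
  The matrix \<open>p\<close> projects onto a complement of \<open>W\<close> in \<open>V\<close>. For a matrix \<open>x\<close> that preserves \<open>V\<close>
  and \<open>W\<close>, the matrix \<open>p x p\<close> is then a square matrix of the original size which describes the
  action of \<open>x\<close> on the quotient \<open>V / W\<close>.
\<close>

lemma relative_projection_exists:
  fixes V W :: "('k::field^'n) set"
  assumes "vec.subspace W" "vec.subspace V" "W \<subseteq> V"
  shows "\<exists>p :: 'k^'n^'n. p ** p = p \<and> (\<forall>w. p *v w \<in> V) \<and> (\<forall>w\<in>W. p *v w = 0) \<and>
    (\<forall>w\<in>V. w - p *v w \<in> W)"
proof -
  obtain q :: "'k^'n^'n" where q: "\<And>w. q *v w \<in> W" "\<And>w. w \<in> W \<Longrightarrow> q *v w = w"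
    using linear_projection_exists[OF assms(1)] by blast
  obtain r :: "'k^'n^'n" where r: "\<And>w. r *v w \<in> V" "\<And>w. w \<in> V \<Longrightarrow> r *v w = w"
    using linear_projection_exists[OF assms(2)] by blast
  define p where "p = r - q ** r"
  have p: "p *v w = r *v w - q *v (r *v w)" for w
    by (simp add: p_def matrix_vector_mult_diff_rdistrib matrix_vector_mul_assoc)
  have pV: "p *v w \<in> V" for w
    unfolding p using q(1) r(1) assms(2,3) by (meson subsetD vec.subspace_diff)
  have "p ** p = p"
    unfolding matrix_eq
  proof
    fix w
    have "p *v (p *v w) = p *v w - q *v (p *v w)" by (simp add: p[of "p *v w"] r(2) pV)
    also have "q *v (p *v w) = 0" by (simp add: p matrix_vector_mult_diff_distrib q)
    finally show "p ** p *v w = p *v w" by (simp add: matrix_vector_mul_assoc)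
  qed
  moreover have "p *v w = 0" if "w \<in> W" for w
    using that assms(3) by (simp add: p q(2) r(2) subsetD)
  moreover have "w - p *v w \<in> W" if "w \<in> V" for w
    using that by (simp add: p q r)
  ultimately show ?thesis using pV by blast
qed

text \<open>
  A nonzero polynomial \<open>p\<close> of least degree with \<open>p(T) u = 0\<close> exists because the iterates of \<open>u\<close>
  are linearly dependent. Splitting off a root \<open>c\<close> as \<open>p = (x - c) q\<close> gives the eigenvector
  \<open>q(T) u\<close>, which is nonzero by minimality.
\<close>

lemma eigenvector_in_invariant_subspace:
  fixes T :: "'k::alg_closed_field^'n^'n"
  assumes V: "vec.subspace V" and inv: "\<And>w. w \<in> V \<Longrightarrow> T *v w \<in> V"
    and u: "u \<in> V" "u \<noteq> 0"
  shows "\<exists>w\<in>V. w \<noteq> 0 \<and> (\<exists>c. T *v w = c *s w)"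
proof -
  define ev where "ev p = (\<Sum>i\<le>Polynomial.degree p. poly.coeff p i *s ((((*v) T) ^^ i) u))" for p
  have ev: "ev p = (\<Sum>i\<le>m. poly.coeff p i *s ((((*v) T) ^^ i) u))"
    if "Polynomial.degree p \<le> m" for p m
    unfolding ev_def using that
    by (intro sum.mono_neutral_left) (auto simp: coeff_eq_0)
  have pow_V: "(((*v) T) ^^ i) u \<in> V" for i by (induction i) (simp_all add: u inv)
  have ev_V: "ev p \<in> V" for p
    unfolding ev_def by (intro vec.subspace_sum V vec.subspace_scale pow_V)
  have ev_root: "ev ([:-c, 1:] * q) = T *v ev q - c *s ev q" for c q
  proof -
    have "Polynomial.degree ([:-c, 1:] * q) \<le> Suc (Polynomial.degree q)"
      using degree_mult_le[of "[:-c, 1:]" q] by simp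
    from ev[OF this] have "ev ([:-c, 1:] * q) =
        (\<Sum>i\<le>Suc (Polynomial.degree q). poly.coeff ([:-c, 1:] * q) i *s ((((*v) T) ^^ i) u))" .
    also have "\<dots> = (\<Sum>i\<le>Suc (Polynomial.degree q). poly.coeff (pCons 0 q) i *s ((((*v) T) ^^ i) u))
        - c *s (\<Sum>i\<le>Suc (Polynomial.degree q). poly.coeff q i *s ((((*v) T) ^^ i) u))"
      unfolding vec.scale_sum_right sum_subtractf[symmetric] vec.scale_scale
        vec.scale_left_diff_distrib[symmetric]
      by (intro sum.cong refl arg_cong2[where f = "(*s)"]) simp
    also have "(\<Sum>i\<le>Suc (Polynomial.degree q). poly.coeff q i *s ((((*v) T) ^^ i) u)) = ev q"
      by (rule ev[symmetric]) simp
    also have "(\<Sum>i\<le>Suc (Polynomial.degree q). poly.coeff (pCons 0 q) i *s ((((*v) T) ^^ i) u)) = T *v ev q"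
      unfolding ev_def sum.atMost_Suc_shift
      by (simp add: vec.linear_sum[OF matrix_vector_mul_linear_gen]
          vec.linear_scale[OF matrix_vector_mul_linear_gen])
    finally show ?thesis .
  qed
  \<comment> \<open>Either two of the first \<open>n + 1\<close> iterates of \<open>u\<close> coincide, or they are \<open>n + 1\<close> distinct vectors.\<close>
  have "\<exists>p. p \<noteq> 0 \<and> ev p = 0"
  proof -
    let ?n = "CARD('n)"
    let ?f = "\<lambda>i. (((*v) T) ^^ i) u"
    show ?thesis
    proof (cases "inj_on ?f {..?n}")
      case True
      have "vec.dependent (?f ` {..?n})"
      proof (rule ccontr)
        assume "vec.independent (?f ` {..?n})"
        from vec.independent_card_le_dim[OF subset_UNIV this] show False
          by (simp only: vec_dim_card card_image[OF True] card_atMost)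
      qed
      then obtain h where h: "\<exists>w\<in>?f ` {..?n}. h w \<noteq> 0" "(\<Sum>w\<in>?f ` {..?n}. h w *s w) = 0"
        by (auto simp: vec.dependent_finite)
      define p where "p = (\<Sum>i\<le>?n. Polynomial.monom (h (?f i)) i)"
      have cp: "poly.coeff p i = (if i \<le> ?n then h (?f i) else 0)" for i
        by (simp add: p_def coeff_sum coeff_monom)
      have "Polynomial.degree p \<le> ?n" by (rule degree_le) (simp add: cp)
      then have "ev p = (\<Sum>i\<le>?n. h (?f i) *s ?f i)" by (simp add: ev cp)
      also have "\<dots> = 0" using h(2) by (simp add: sum.reindex[OF True])
      finally have "ev p = 0" .
      moreover have "p \<noteq> 0"
      proof
        assume "p = 0"
        then have "h (?f i) = 0" if "i \<le> ?n" for i using cp[of i] that by simp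
        then show False using h(1) by blast
      qed
      ultimately show ?thesis by blast
    next
      case False
      then obtain i j where ij: "i \<noteq> j" "?f i = ?f j" by (auto simp: inj_on_def)
      define p where "p = Polynomial.monom (1::'k) i - Polynomial.monom 1 j"
      have "poly.coeff p i = 1" using ij(1) by (simp add: p_def)
      have dp: "Polynomial.degree p \<le> max i j"
        unfolding p_def by (rule order.trans[OF degree_diff_le_max]) (simp add: degree_monom_eq)
      have "ev p = (\<Sum>l\<le>max i j. (if l = i then ?f l else 0) - (if l = j then ?f l else 0))"
        unfolding ev[OF dp] by (intro sum.cong) (auto simp: p_def coeff_monom)
      also have "\<dots> = ?f i - ?f j" by (simp add: sum_subtractf)
      finally show ?thesis using ij \<open>poly.coeff p i = 1\<close> by (intro exI[of _ p]) auto
    qed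
  qed
  then obtain p where p: "p \<noteq> 0" "ev p = 0"
    and least: "\<And>q. q \<noteq> 0 \<Longrightarrow> ev q = 0 \<Longrightarrow> Polynomial.degree p \<le> Polynomial.degree q"
    using ex_has_least_nat[of "\<lambda>p. p \<noteq> 0 \<and> ev p = 0" _ Polynomial.degree] by blast
  have "Polynomial.degree p > 0"
  proof (rule ccontr)
    assume "\<not> Polynomial.degree p > 0"
    then have "ev p = poly.coeff p 0 *s u" "poly.coeff p 0 \<noteq> 0"
      using p(1) by (auto simp: ev_def leading_coeff_0_iff[symmetric] simp del: leading_coeff_0_iff)
    then show False using p(2) u(2) by simp
  qed
  then obtain c where "poly p c = 0" using alg_closed_imp_poly_has_root by blast
  then obtain q where q: "p = [:-c, 1:] * q" by (metis poly_eq_0_iff_dvd dvdE)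
  with p(1) have "q \<noteq> 0" by auto
  have "Polynomial.degree p = Suc (Polynomial.degree q)" unfolding q using \<open>q \<noteq> 0\<close>
    by (subst degree_mult_eq) auto
  then have "ev q \<noteq> 0" using least[OF \<open>q \<noteq> 0\<close>] by auto
  moreover have "T *v ev q = c *s ev q" using p(2) ev_root[of c q] by (simp add: q)
  ultimately show ?thesis using ev_V by blast
qed


section \<open>Kolchin's theorem\<close>

text \<open>
  A kernel vector inside \<open>V\<close> makes the image of \<open>V\<close> smaller: a linear section of \<open>V \<rightarrow> A V\<close> with
  values in \<open>V\<close> would otherwise be onto \<open>V\<close>, hence would reach that vector.
\<close>

lemma dim_image_less:
  fixes A :: "'k::field^'n^'n"
  assumes V: "vec.subspace V" and t: "t \<in> V" "t \<noteq> 0" "A *v t = 0"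
  shows "vec.dim ((*v) A ` V) < vec.dim V"
proof (rule ccontr)
  assume not: "\<not> ?thesis"
  let ?Z = "(*v) A ` V"
  have subZ: "vec.subspace ?Z" by (rule vec.subspace_image[OF V])
  obtain g where g: "g ` UNIV \<subseteq> V" "Vector_Spaces.linear (*s) (*s) g" "\<forall>w\<in>?Z. A *v g w = w"
    using vec.linear_exists_right_inverse_on[OF matrix_vector_mul_linear_gen V] by blast
  have "inj_on g ?Z" using g(3) by (metis inj_onI)
  then have "vec.dim (g ` ?Z) = vec.dim ?Z"
    by (intro vec.dim_image_eq[OF g(2)]) (simp only: vec.span_eq_iff[THEN iffD2, OF subZ])
  then have "g ` ?Z = V"
    using g(1) not by (intro vec.subspace_dim_equal vec.linear_subspace_image[OF g(2) subZ] V) auto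
  then obtain s where "s \<in> ?Z" "t = g s" using t(1) by blast
  then have "t = g 0" using g(3) t(3) by auto
  then show False using t(2) vec.linear_0[OF g(2)] by simp
qed

definition stable_subspace :: "('k::field^'n^'n) set \<Rightarrow> ('k^'n) set \<Rightarrow> bool" where
  "stable_subspace S V \<longleftrightarrow> vec.subspace V \<and> (\<forall>s\<in>S. \<forall>w\<in>V. s *v w \<in> V)"

lemma stable_subspace_span:
  assumes "stable_subspace S V" "z \<in> matrix_space.span S" "w \<in> V"
  shows "z *v w \<in> V"
  using assms(2)
proof (induction rule: matrix_space.span_induct_alt)
  case base
  then show ?case using assms(1) by (simp add: stable_subspace_def vec.subspace_0)
next
  case (step c x y)
  then show ?case using assms(1,3)
    by (simp add: stable_subspace_def matrix_vector_mult_add_rdistrib mat_matrix_mult_vector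
        vec.subspace_add vec.subspace_scale)
qed

text \<open>
  This is the core of Kolchin's theorem. Let \<open>I\<close> be the algebra spanned by \<open>S\<close>, and suppose that
  it acts nontrivially on the simple quotient \<open>V / W\<close>. By simplicity \<open>I\<close> moves every nonzero
  vector of \<open>V / W\<close> to every other one. An element \<open>x\<close> of \<open>I\<close> whose action \<open>\<rho> x\<close> is nonzero of
  least rank has rank one: otherwise, for a suitable \<open>b\<close>, subtracting an eigenvalue from
  \<open>\<rho> (x b)\<close> on the range of \<open>\<rho> x\<close> would give an element of smaller rank. By transitivity some
  multiple of \<open>x\<close> is then a projection of rank one on \<open>V / W\<close>, so it has trace one. But the
  trace vanishes on \<open>I\<close>, because \<open>I\<close> is spanned by nilpotent matrices.
\<close>

lemma span_nilpotent_vanishes_on_simple: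
  fixes S :: "('k::alg_closed_field^'n^'n) set"
  assumes mult: "\<And>x y. x \<in> S \<Longrightarrow> y \<in> S \<Longrightarrow> x ** y \<in> matrix_space.span S"
    and nilp: "\<And>x. x \<in> S \<Longrightarrow> \<exists>m. (((**) x) ^^ m) x = 0"
    and W: "stable_subspace S W" and V: "stable_subspace S V" and WV: "W \<subseteq> V"
    and simple: "\<And>Z. stable_subspace S Z \<Longrightarrow> W \<subseteq> Z \<Longrightarrow> Z \<subseteq> V \<Longrightarrow> Z = W \<or> Z = V"
    and z: "z \<in> S" "w \<in> V"
  shows "z *v w \<in> W"
proof (rule ccontr)
  assume zw: "z *v w \<notin> W"
  let ?I = "matrix_space.span S"
  have subW: "vec.subspace W" and subV: "vec.subspace V" using W V
    by (auto simp: stable_subspace_def)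
  have IW: "x *v u \<in> W" if "x \<in> ?I" "u \<in> W" for x u using stable_subspace_span[OF W that] .
  have IV: "x *v u \<in> V" if "x \<in> ?I" "u \<in> V" for x u using stable_subspace_span[OF V that] .
  have I_mult: "x ** y \<in> ?I" if "x \<in> ?I" "y \<in> ?I" for x y
    using that(1)
  proof (induction rule: matrix_space.span_induct_alt)
    case base
    then show ?case by (simp add: matrix_space.span_zero)
  next
    case (step c x x')
    have "x ** y \<in> ?I"
      using that(2)
    proof (induction rule: matrix_space.span_induct_alt)
      case base
      then show ?case by (simp add: matrix_space.span_zero)
    next
      case (step d y y')
      have "x ** (mat d ** y + y') = mat d ** (x ** y) + x ** y'"
        by (simp add: matrix_add_ldistrib matrix_mul_assoc matrix_mat_commute)
      then show ?case
        using step mult \<open>x \<in> S\<close> by (simp add: matrix_space.span_add matrix_space.span_scale)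
    qed
    then show ?case
      using step
      by (simp add: matrix_add_rdistrib matrix_mul_assoc[symmetric] matrix_space.span_add
          matrix_space.span_scale)
  qed
  \<comment> \<open>The vectors of \<open>V\<close> that \<open>I\<close> sends into \<open>W\<close> form a stable subspace, which is \<open>W\<close> since \<open>z\<close> acts
    nontrivially; so \<open>I u + W\<close> is a stable subspace larger than \<open>W\<close>.\<close>
  have transitive: "\<exists>x\<in>?I. x *v u - t \<in> W" if u: "u \<in> V" "u \<notin> W" and t: "t \<in> V" for u t
  proof -
    define Z where "Z = {y \<in> V. \<forall>x\<in>?I. x *v y \<in> W}"
    have "stable_subspace S Z"
      unfolding stable_subspace_def Z_def vec.subspace_def
      using subV subW I_mult matrix_space.span_base[of _ S] V
      by (auto simp: matrix_vector_right_distrib vec.subspace_add vec.subspace_0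
          vec.subspace_scale stable_subspace_def matrix_vector_mul_assoc
          vec.linear_scale[OF matrix_vector_mul_linear_gen])
    moreover have "W \<subseteq> Z" "Z \<subseteq> V" using IW WV by (auto simp: Z_def)
    moreover have "Z \<noteq> V" using zw z matrix_space.span_base[of z S] by (auto simp: Z_def)
    ultimately have "Z = W" using simple by blast
    then obtain x0 where x0: "x0 \<in> ?I" "x0 *v u \<notin> W" using u by (auto simp: Z_def)
    define Y where "Y = {x *v u + y | x y. x \<in> ?I \<and> y \<in> W}"
    have "vec.subspace Y"
      unfolding vec.subspace_def
    proof (intro conjI ballI allI)
      show "0 \<in> Y"
        unfolding Y_def using vec.subspace_0[OF subW] matrix_space.span_zero[of S]
        by (intro CollectI exI[of _ 0]) simp
    next
      fix p q assume "p \<in> Y" "q \<in> Y"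
      then obtain x y x' y' where "p = x *v u + y" "q = x' *v u + y'" "x \<in> ?I" "x' \<in> ?I"
        "y \<in> W" "y' \<in> W"
        unfolding Y_def by blast
      then show "p + q \<in> Y"
        unfolding Y_def
        by (intro CollectI exI[of _ "x + x'"] exI[of _ "y + y'"])
          (simp add: matrix_vector_mult_add_rdistrib matrix_space.span_add vec.subspace_add[OF subW])
    next
      fix c p assume "p \<in> Y"
      then obtain x y where "p = x *v u + y" "x \<in> ?I" "y \<in> W" unfolding Y_def by blast
      then show "c *s p \<in> Y"
        unfolding Y_def
        by (intro CollectI exI[of _ "mat c ** x"] exI[of _ "c *s y"])
          (simp add: mat_matrix_mult_vector vec.scale_right_distrib matrix_space.span_scale
            vec.subspace_scale[OF subW])
    qed
    moreover have "s *v p \<in> Y" if "s \<in> S" "p \<in> Y" for s p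
    proof -
      obtain x y where xy: "p = x *v u + y" "x \<in> ?I" "y \<in> W" using \<open>p \<in> Y\<close> unfolding Y_def by blast
      have "s \<in> ?I" using \<open>s \<in> S\<close> by (rule matrix_space.span_base)
      with xy show ?thesis
        unfolding Y_def
        by (intro CollectI exI[of _ "s ** x"] exI[of _ "s *v y"])
          (simp add: matrix_vector_right_distrib matrix_vector_mul_assoc I_mult IW)
    qed
    ultimately have "stable_subspace S Y" by (simp add: stable_subspace_def)
    moreover have "W \<subseteq> Y"
      unfolding Y_def using matrix_space.span_zero[of S] by (force intro: exI[of _ 0])
    moreover have "Y \<subseteq> V"
      unfolding Y_def using IV u(1) WV vec.subspace_add[OF subV] by blast
    moreover have "Y \<noteq> W"
      unfolding Y_def using x0 vec.subspace_0[OF subW] by (force intro: exI[of _ 0])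
    ultimately have "Y = V" using simple by blast
    then obtain x y where "t = x *v u + y" "x \<in> ?I" "y \<in> W" using t unfolding Y_def by blast
    then show ?thesis using vec.subspace_neg[OF subW, of y] by (intro bexI[of _ x]) simp_all
  qed
  obtain p :: "'k^'n^'n" where pp: "p ** p = p" and pV: "\<And>u. p *v u \<in> V"
    and pW: "\<And>u. u \<in> W \<Longrightarrow> p *v u = 0" and p_mod: "\<And>u. u \<in> V \<Longrightarrow> u - p *v u \<in> W"
    using relative_projection_exists[OF subW subV WV] by metis
  have p_eq: "p *v u = p *v u'" if "u - u' \<in> W" for u u'
    using pW[OF that] by (simp add: matrix_vector_mult_diff_distrib)
  have pp_v: "p *v (p *v u) = p *v u" for u by (simp add: matrix_vector_mul_assoc pp)
  have p_0: "u \<in> W" if "u \<in> V" "p *v u = 0" for u using p_mod[OF that(1)] that(2) by simp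
  define \<rho> where "\<rho> x = p ** x ** p" for x
  have \<rho>_v: "\<rho> x *v u = p *v (x *v (p *v u))" for x u
    by (simp add: \<rho>_def matrix_vector_mul_assoc matrix_mul_assoc)
  have p_\<rho>: "p *v (\<rho> x *v u) = \<rho> x *v u" and \<rho>_p: "\<rho> x *v (p *v u) = \<rho> x *v u" for x u
    by (simp_all add: \<rho>_v pp_v)
  have \<rho>_mult: "\<rho> (x ** y) = \<rho> x ** \<rho> y" if "x \<in> ?I" "y \<in> ?I" for x y
    unfolding matrix_eq
  proof
    fix u
    have "y *v (p *v u) - p *v (y *v (p *v u)) \<in> W" by (rule p_mod) (rule IV[OF that(2) pV])
    from IW[OF that(1) this]
    have "p *v (x *v (y *v (p *v u))) = p *v (x *v (p *v (y *v (p *v u))))"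
      by (intro p_eq) (simp add: matrix_vector_mult_diff_distrib)
    then show "\<rho> (x ** y) *v u = \<rho> x ** \<rho> y *v u"
      by (simp add: \<rho>_v matrix_vector_mul_assoc[symmetric] pp_v)
  qed
  have trace_\<rho>: "trace (\<rho> x) = 0" if "x \<in> ?I" for x
    using that
  proof (induction rule: matrix_space.span_induct_alt)
    case base
    then show ?case by (simp add: \<rho>_def trace_def)
  next
    case (step c x y)
    obtain m where m: "(((**) x) ^^ m) x = 0" using nilp step.hyps by blast
    have xI: "x \<in> ?I" using step.hyps by (rule matrix_space.span_base)
    have "(((**) (\<rho> x)) ^^ j) (\<rho> x) = \<rho> ((((**) x) ^^ j) x) \<and> (((**) x) ^^ j) x \<in> ?I" for j
      by (induction j) (simp_all add: xI I_mult \<rho>_mult)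
    then have "(((**) (\<rho> x)) ^^ m) (\<rho> x) = 0" by (simp add: m \<rho>_def)
    then have "trace (\<rho> x) = 0" by (rule trace_nilpotent_matrix)
    moreover have "\<rho> (mat c ** x + y) = mat c ** \<rho> x + \<rho> y"
      by (simp add: \<rho>_def matrix_add_ldistrib matrix_add_rdistrib matrix_mul_assoc matrix_mat_commute)
    moreover have "trace (mat c ** A) = c * trace A" for A :: "'k^'n^'n"
      by (simp add: trace_def matrix_matrix_mult_def mat_def sum_distrib_left
          if_distrib[of "\<lambda>x. x * _"] cong: if_cong)
    ultimately show ?case using step by (simp add: trace_add)
  qed
  have "\<rho> z \<noteq> 0"
  proof
    assume "\<rho> z = 0"
    then have "p *v (z *v (p *v w)) = 0" using \<rho>_v[of z w] by simp
    moreover have zI: "z \<in> ?I" using z(1) by (rule matrix_space.span_base)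
    ultimately have "z *v (p *v w) \<in> W" using p_0 IV pV by blast
    moreover have "z *v (w - p *v w) \<in> W" using IW[OF zI p_mod[OF z(2)]] .
    ultimately have "z *v (p *v w) + z *v (w - p *v w) \<in> W" by (rule vec.subspace_add[OF subW])
    then show False using zw by (simp add: matrix_vector_mult_diff_distrib)
  qed
  then have "z \<in> ?I \<and> \<rho> z \<noteq> 0" using z(1) by (simp add: matrix_space.span_base)
  then obtain x where x: "x \<in> ?I" "\<rho> x \<noteq> 0" and least:
    "\<And>y. y \<in> ?I \<Longrightarrow> \<rho> y \<noteq> 0 \<Longrightarrow> vec.dim (range ((*v) (\<rho> x))) \<le> vec.dim (range ((*v) (\<rho> y)))"
    using ex_has_least_nat[of "\<lambda>x. x \<in> ?I \<and> \<rho> x \<noteq> 0" z "\<lambda>x. vec.dim (range ((*v) (\<rho> x)))"]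
    by blast
  define R where "R = \<rho> x"
  obtain y1 where "R *v y1 \<noteq> 0" using x(2) by (auto simp: R_def matrix_eq)
  define u where "u = R *v y1"
  have u0: "u \<noteq> 0" using \<open>R *v y1 \<noteq> 0\<close> by (simp add: u_def)
  have pu: "p *v u = u" by (simp add: u_def R_def p_\<rho>)
  have u: "u \<in> V" "u \<notin> W" using pV[of u] pW[of u] pu u0 by auto
  have reach: "\<exists>b\<in>?I. \<rho> b *v u = p *v t" for t
  proof -
    obtain b where b: "b \<in> ?I" "b *v u - p *v t \<in> W" using transitive[OF u pV] by blast
    have "\<rho> b *v u = p *v (b *v u)" by (simp add: \<rho>_v pu)
    also have "\<dots> = p *v (p *v t)" using b(2) by (rule p_eq)
    finally show ?thesis using b(1) by (auto simp: pp_v)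
  qed
  have rank_one: "\<exists>c. R *v y = c *s u" for y
  proof -
    obtain b where b: "b \<in> ?I" "\<rho> b *v u = p *v y" using reach by blast
    define T where "T = R ** \<rho> b"
    have subR: "vec.subspace (range ((*v) R))" by (rule vec.subspace_image) simp
    have "\<exists>t\<in>range ((*v) R). t \<noteq> 0 \<and> (\<exists>c. T *v t = c *s t)"
      using u0 by (intro eigenvector_in_invariant_subspace[OF subR, of _ u])
        (auto simp: T_def u_def matrix_vector_mul_assoc[symmetric])
    then obtain t c where t: "t \<in> range ((*v) R)" "t \<noteq> 0" "T *v t = c *s t" by blast
    \<comment> \<open>Since \<open>\<rho> x' = (T - c) R\<close> and \<open>T - c\<close> is singular on the range of \<open>R\<close>, the rank drops.\<close>
    define x' where "x' = x ** b ** x - mat c ** x"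
    have x': "x' \<in> ?I"
      unfolding x'_def
      by (intro matrix_space.span_diff I_mult matrix_space.span_scale x(1) b(1))
    have \<rho>_diff: "\<rho> (A - B) = \<rho> A - \<rho> B" for A B
      by (simp add: matrix_eq \<rho>_v matrix_vector_mult_diff_rdistrib matrix_vector_mult_diff_distrib)
    have \<rho>_scale: "\<rho> (mat c ** A) = mat c ** \<rho> A" for c A
      by (simp add: \<rho>_def matrix_mul_assoc matrix_mat_commute)
    have \<rho>x': "\<rho> x' *v y = (T - mat c) *v (R *v y)" for y
    proof -
      have "mat c *v s = c *s s" for s :: "'k^'n"
        using mat_matrix_mult_vector[of c "mat 1" s] by simp
      moreover have "\<rho> x' = R ** \<rho> b ** R - mat c ** R"
        unfolding x'_def \<rho>_diff \<rho>_scale using x(1) b(1) by (simp add: \<rho>_mult I_mult R_def)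
      ultimately show ?thesis
        by (simp add: T_def matrix_vector_mult_diff_rdistrib matrix_vector_mul_assoc[symmetric]
            mat_matrix_mult_vector)
    qed
    have "vec.dim (range ((*v) (\<rho> x'))) < vec.dim (range ((*v) R))"
    proof -
      have "range ((*v) (\<rho> x')) = (*v) (T - mat c) ` range ((*v) R)" by (auto simp: \<rho>x')
      moreover have "(T - mat c) *v t = 0"
        using t(3) mat_matrix_mult_vector[of c "mat 1" t]
          by (simp add: matrix_vector_mult_diff_rdistrib)
      ultimately show ?thesis using dim_image_less[OF subR t(1,2)] by simp
    qed
    then have "\<rho> x' = 0" using least[OF x'] by (auto simp: R_def)
    then have "T *v u = c *s u"
      using \<rho>x'[of y1] mat_matrix_mult_vector[of c "mat 1" u]
      by (simp add: u_def matrix_vector_mult_diff_rdistrib)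
    moreover have "T *v u = R *v y"
      by (simp add: T_def matrix_vector_mul_assoc[symmetric] b(2)) (simp add: R_def \<rho>_p)
    ultimately show ?thesis by metis
  qed
  \<comment> \<open>The rank one matrix \<open>E\<close> fixes the vector \<open>t\<close> that spans its range, so it has trace one.\<close>
  obtain b where b: "b \<in> ?I" "\<rho> b *v u = p *v y1" using reach by blast
  define E where "E = \<rho> (b ** x)"
  define t where "t = p *v y1"
  have E: "E = \<rho> b ** R" using \<rho>_mult[OF b(1) x(1)] by (simp add: E_def R_def)
  have "\<exists>c. E *v y = c *s t" for y
    using rank_one[of y] b(2)
    by (auto simp: E t_def matrix_vector_mul_assoc[symmetric]
        vec.linear_scale[OF matrix_vector_mul_linear_gen])
  then obtain \<phi> where \<phi>: "\<And>y. E *v y = \<phi> y *s t" by metis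
  have "R *v t = u" by (simp add: t_def u_def R_def \<rho>_p)
  then have Et: "E *v t = t" using b(2) by (simp add: E t_def matrix_vector_mul_assoc[symmetric])
  have entry: "E $ i $ j = t $ i * \<phi> (axis j 1)" for i j
  proof -
    have "(E *v axis j 1) $ i = E $ i $ j"
      by (simp add: matrix_vector_mult_def axis_def if_distrib[of "\<lambda>x. _ * x"] cong: if_cong)
    then show ?thesis unfolding \<phi> vector_smult_component by (simp only: mult.commute)
  qed
  have "t \<noteq> 0" using \<open>R *v t = u\<close> u0 matrix_vector_mult_0_right[of R] by metis
  then obtain i where i: "t $ i \<noteq> 0" by (auto simp: vec_eq_iff)
  have "(\<Sum>j\<in>UNIV. E $ i $ j * t $ j) = (E *v t) $ i"
    by (simp only: matrix_vector_mult_def vec_lambda_beta)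
  then have "t $ i = (\<Sum>j\<in>UNIV. t $ i * (t $ j * \<phi> (axis j 1)))"
    unfolding Et by (simp only: entry mult.assoc mult.commute[of "\<phi> _"])
  also have "\<dots> = t $ i * trace E"
    by (simp only: trace_def entry sum_distrib_left)
  finally have "trace E = 1" using i by (metis mult_cancel_left1)
  moreover have "trace E = 0" unfolding E_def by (intro trace_\<rho> I_mult b(1) x(1))
  ultimately show False by simp
qed

text \<open>
  Iterating this operation, starting with the whole space, gives the filtration by the subspaces
  \<open>I ^ k V\<close>, where \<open>I\<close> is the linear span of \<open>S\<close>. Its vanishing at some stage says that all
  products of \<open>k\<close> elements of \<open>S\<close> are zero.
\<close>

definition image_span :: "('k::field^'n^'n) set \<Rightarrow> ('k^'n) set \<Rightarrow> ('k^'n) set" where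
  "image_span S V = vec.span {s *v w | s w. s \<in> S \<and> w \<in> V}"

lemma image_span_mono: "V \<subseteq> W \<Longrightarrow> image_span S V \<subseteq> image_span S W"
  unfolding image_span_def by (rule vec.span_mono) blast

lemma image_span_funpow_mono: "V \<subseteq> W \<Longrightarrow> (image_span S ^^ k) V \<subseteq> (image_span S ^^ k) W"
  by (induction k) (simp_all add: image_span_mono)

lemma image_span_minimal:
  assumes "vec.subspace W" "\<And>s w. s \<in> S \<Longrightarrow> w \<in> V \<Longrightarrow> s *v w \<in> W"
  shows "image_span S V \<subseteq> W"
  unfolding image_span_def using assms by (intro vec.span_minimal) auto

text \<open>
  By induction on the dimension of a stable subspace \<open>V\<close>: a proper stable subspace \<open>W\<close> of the
  largest possible dimension has a simple quotient \<open>V / W\<close>, so \<open>S\<close> sends \<open>V\<close> into \<open>W\<close>.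
\<close>

lemma span_nilpotent_imp_image_span_nilpotent:
  fixes S :: "('k::alg_closed_field^'n^'n) set"
  assumes mult: "\<And>x y. x \<in> S \<Longrightarrow> y \<in> S \<Longrightarrow> x ** y \<in> matrix_space.span S"
    and nilp: "\<And>x. x \<in> S \<Longrightarrow> \<exists>m. (((**) x) ^^ m) x = 0"
  shows "\<exists>k. (image_span S ^^ k) UNIV \<subseteq> {0}"
proof -
  have "\<exists>k. (image_span S ^^ k) V \<subseteq> {0}" if "stable_subspace S V" for V
    using that
  proof (induction "vec.dim V" arbitrary: V rule: less_induct)
    case less
    show ?case
    proof (cases "V = {0}")
      case True
      then show ?thesis by (intro exI[of _ 0]) simp
    next
      case False
      have subV: "vec.subspace V" using less.prems by (simp add: stable_subspace_def)
      let ?P = "\<lambda>W. stable_subspace S W \<and> W \<subset> V"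
      have "?P {0}"
        using False vec.subspace_0[OF subV]
        by (auto simp: stable_subspace_def matrix_vector_mult_0_right)
      moreover have "\<forall>W. ?P W \<longrightarrow> vec.dim W < Suc (CARD('n))"
        by (auto simp: less_Suc_eq_le intro: dim_subset_UNIV_cart_gen)
      ultimately obtain W where W: "?P W" and greatest: "\<And>Z. ?P Z \<Longrightarrow> vec.dim Z \<le> vec.dim W"
        using ex_has_greatest_nat[of ?P "{0}" vec.dim "Suc (CARD('n))"] by blast
      have subW: "vec.subspace W" using W by (simp add: stable_subspace_def)
      have "s *v w \<in> W" if "s \<in> S" "w \<in> V" for s w
      proof (rule span_nilpotent_vanishes_on_simple[OF mult nilp _ less.prems _ _ that])
        fix Z assume Z: "stable_subspace S Z" "W \<subseteq> Z" "Z \<subseteq> V"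
        show "Z = W \<or> Z = V"
          using vec.subspace_dim_equal[OF subW _ Z(2)] greatest[of Z] Z
            by (auto simp: stable_subspace_def)
      qed (use W in auto)
      then have "image_span S V \<subseteq> W" by (intro image_span_minimal subW)
      moreover have "vec.dim W < vec.dim V"
        using W subW subV vec.dim_psubset[of W V] by (metis vec.span_eq_iff)
      then obtain k where "(image_span S ^^ k) W \<subseteq> {0}" using less.hyps W by blast
      ultimately have "(image_span S ^^ Suc k) V \<subseteq> {0}"
        using image_span_funpow_mono[of "image_span S V" W k S] by (simp add: funpow_swap1)
      then show ?thesis ..
    qed
  qed
  then show ?thesis by (simp add: stable_subspace_def)
qed

text \<open>
  Kolchin's theorem. The identity \<open>(a - 1) (b - 1) = (a b - 1) - (a - 1) - (b - 1)\<close> shows that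
  the differences \<open>x - 1\<close> span an algebra.
\<close>

lemma kolchin:
  fixes N :: "('k::alg_closed_field^'n^'n) set"
  assumes mult: "\<And>x y. x \<in> N \<Longrightarrow> y \<in> N \<Longrightarrow> x ** y \<in> N"
    and unip: "\<And>x. x \<in> N \<Longrightarrow> \<exists>m. (((**) (x - mat 1)) ^^ m) (mat 1) = 0"
  shows "\<exists>k. (image_span ((\<lambda>x. x - mat 1) ` N) ^^ k) UNIV \<subseteq> {0}"
proof (rule span_nilpotent_imp_image_span_nilpotent)
  let ?S = "(\<lambda>x. x - mat 1) ` N"
  fix x y assume "x \<in> ?S" "y \<in> ?S"
  then obtain a b where ab: "a \<in> N" "b \<in> N" "x = a - mat 1" "y = b - mat 1" by blast
  have "x ** y = (a ** b - mat 1) - x - y"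
    by (simp add: ab matrix_eq matrix_vector_mult_diff_rdistrib matrix_vector_mult_diff_distrib
        matrix_vector_mul_assoc[symmetric])
  moreover have "a ** b - mat 1 \<in> ?S" using ab mult by blast
  ultimately show "x ** y \<in> matrix_space.span ?S"
    using \<open>x \<in> ?S\<close> \<open>y \<in> ?S\<close> by (simp add: matrix_space.span_diff matrix_space.span_base)
next
  fix x assume "x \<in> (\<lambda>x. x - mat 1) ` N"
  then obtain m where "(((**) x) ^^ m) (mat 1) = 0" using unip by blast
  then have "(((**) x) ^^ m) x = 0" using matrix_funpow_mult[of m x "mat 1" x] by simp
  then show "\<exists>m. (((**) x) ^^ m) x = 0" ..
qed

text \<open>
  Every \<open>x - 1\<close> moves the Kolchin filtration by one step, so the length of the filtration is a
  common exponent.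
\<close>

lemma unipotent_exponent:
  fixes N :: "('k::alg_closed_field^'n^'n) set"
  assumes "\<And>x y. x \<in> N \<Longrightarrow> y \<in> N \<Longrightarrow> x ** y \<in> N"
    and "\<And>x. x \<in> N \<Longrightarrow> \<exists>m. (((**) (x - mat 1)) ^^ m) (mat 1) = 0"
  shows "\<exists>k. \<forall>x\<in>N. (((**) (x - mat 1)) ^^ k) (mat 1) = 0"
proof -
  let ?D = "image_span ((\<lambda>x. x - mat 1) ` N)"
  obtain k where k: "(?D ^^ k) UNIV \<subseteq> {0}" using kolchin[OF assms] by blast
  have "(((*v) (x - mat 1)) ^^ j) w \<in> (?D ^^ j) UNIV" if "x \<in> N" for x w j
  proof (induction j)
    case (Suc j)
    then show ?case
      using that by (auto simp: image_span_def intro!: vec.span_base)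
  qed simp
  then show ?thesis using k by (intro exI[of _ k]) (auto simp: matrix_funpow_eq_0_iff)
qed

text \<open>
  Let \<open>V\<^sub>0 \<supseteq> V\<^sub>1 \<supseteq> \<dots>\<close> be the Kolchin filtration of \<open>N\<^sub>1\<close>. It is stable under \<open>N\<^sub>2\<close>, which
  normalizes \<open>N\<^sub>1\<close>. On each quotient of successive steps the group \<open>N\<^sub>1\<close> acts trivially, so
  \<open>x y\<close> acts there like the unipotent matrix \<open>y\<close>. Hence the power of \<open>x y - 1\<close> given by a common
  exponent for \<open>N\<^sub>2\<close> moves each step of the filtration into the next. The resulting exponent is
  independent of \<open>x\<close> and \<open>y\<close>, so that it describes a Zariski closed condition.
\<close>

lemma unipotent_product:
  fixes N\<^sub>1 N\<^sub>2 :: "('k::alg_closed_field^'n^'n) set"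
  assumes mult\<^sub>1: "\<And>x y. x \<in> N\<^sub>1 \<Longrightarrow> y \<in> N\<^sub>1 \<Longrightarrow> x ** y \<in> N\<^sub>1"
    and unip\<^sub>1: "\<And>x. x \<in> N\<^sub>1 \<Longrightarrow> \<exists>m. (((**) (x - mat 1)) ^^ m) (mat 1) = 0"
    and mult\<^sub>2: "\<And>x y. x \<in> N\<^sub>2 \<Longrightarrow> y \<in> N\<^sub>2 \<Longrightarrow> x ** y \<in> N\<^sub>2"
    and unip\<^sub>2: "\<And>x. x \<in> N\<^sub>2 \<Longrightarrow> \<exists>m. (((**) (x - mat 1)) ^^ m) (mat 1) = 0"
    and one: "mat 1 \<in> N\<^sub>1"
    and normalizes: "\<And>x y. x \<in> N\<^sub>1 \<Longrightarrow> y \<in> N\<^sub>2 \<Longrightarrow> \<exists>x'\<in>N\<^sub>1. y ** x = x' ** y"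
  shows "\<exists>k. \<forall>x\<in>N\<^sub>1. \<forall>y\<in>N\<^sub>2. (((**) (x ** y - mat 1)) ^^ k) (mat 1) = 0"
proof -
  let ?D = "image_span ((\<lambda>x. x - mat 1) ` N\<^sub>1)"
  let ?V = "\<lambda>i. (?D ^^ i) UNIV"
  obtain k\<^sub>1 where k\<^sub>1: "?V k\<^sub>1 \<subseteq> {0}" using kolchin[OF mult\<^sub>1 unip\<^sub>1] by blast
  obtain k\<^sub>2 where k\<^sub>2: "\<And>y. y \<in> N\<^sub>2 \<Longrightarrow> (((**) (y - mat 1)) ^^ k\<^sub>2) (mat 1) = 0"
    using unipotent_exponent[OF mult\<^sub>2 unip\<^sub>2] by blast
  have subV: "vec.subspace (?V i)" for i by (cases i) (simp_all add: image_span_def)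
  have V_Suc: "(x - mat 1) *v w \<in> ?V (Suc i)" if "x \<in> N\<^sub>1" "w \<in> ?V i" for x w i
    using that by (auto simp: image_span_def intro!: vec.span_base)
  have N\<^sub>2_V: "y *v w \<in> ?V i" if y: "y \<in> N\<^sub>2" and w: "w \<in> ?V i" for y w i
    using w
  proof (induction i arbitrary: w)
    case (Suc i)
    have "?V (Suc i) \<subseteq> (*v) y -` ?V (Suc i)"
      unfolding funpow.simps comp_def
    proof (rule image_span_minimal)
      show "vec.subspace ((*v) y -` ?D (?V i))"
        using subV[of "Suc i"] by (intro vec.subspace_vimage) simp
    next
      fix s u assume s: "s \<in> (\<lambda>x. x - mat 1) ` N\<^sub>1" and u: "u \<in> ?V i"
      then obtain x where x: "x \<in> N\<^sub>1" "s = x - mat 1" by blast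
      obtain x' where x': "x' \<in> N\<^sub>1" "y ** x = x' ** y" using normalizes[OF x(1) y] by blast
      have "y *v (x *v u) = x' *v (y *v u)" by (simp add: matrix_vector_mul_assoc x'(2))
      then have "y *v (s *v u) = (x' - mat 1) *v (y *v u)"
        by (simp add: x(2) matrix_vector_mult_diff_rdistrib matrix_vector_mult_diff_distrib)
      moreover have "(x' - mat 1) *v (y *v u) \<in> ?V (Suc i)"
        by (rule V_Suc[OF x'(1) Suc.IH[OF u]])
      ultimately show "s *v u \<in> (*v) y -` ?D (?V i)" by simp
    qed
    then show ?case using Suc.prems by blast
  qed simp
  have V_antimono: "?V (Suc i) \<subseteq> ?V i" for i
  proof (induction i)
    case (Suc i)
    then show ?case using image_span_mono[of "?V (Suc i)" "?V i"] by simp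
  qed simp
  have step: "(((*v) (x ** y - mat 1)) ^^ k\<^sub>2) w \<in> ?V (Suc i)"
    if x: "x \<in> N\<^sub>1" and y: "y \<in> N\<^sub>2" and w: "w \<in> ?V i" for x y w i
  proof -
    have y_V: "(((*v) (y - mat 1)) ^^ j) w \<in> ?V i" for j
      by (induction j)
        (use w N\<^sub>2_V[OF y] vec.subspace_diff[OF subV] in \<open>auto simp: matrix_vector_mult_diff_rdistrib\<close>)
    \<comment> \<open>Modulo the next step of the filtration, \<open>x y - 1\<close> and \<open>y - 1\<close> agree.\<close>
    have "(((*v) (x ** y - mat 1)) ^^ j) w - (((*v) (y - mat 1)) ^^ j) w \<in> ?V (Suc i)" for j
    proof (induction j)
      case 0
      then show ?case using vec.subspace_0[OF subV[of "Suc i"]] by simp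
    next
      case (Suc j)
      let ?g = "(((*v) (x ** y - mat 1)) ^^ j) w" and ?h = "(((*v) (y - mat 1)) ^^ j) w"
      have "(((*v) (x ** y - mat 1)) ^^ Suc j) w - (((*v) (y - mat 1)) ^^ Suc j) w =
          (x - mat 1) *v (y *v ?h) + ((x - mat 1) *v (y *v (?g - ?h)) + (y *v (?g - ?h) - (?g - ?h)))"
        by (simp add: matrix_vector_mult_diff_rdistrib matrix_vector_mult_diff_distrib
            matrix_vector_mul_assoc[symmetric])
      also have "\<dots> \<in> ?V (Suc i)"
      proof (rule vec.subspace_add[OF subV _ vec.subspace_add[OF subV _ vec.subspace_diff[OF subV]]])
        show "(x - mat 1) *v (y *v ?h) \<in> ?V (Suc i)" by (rule V_Suc[OF x N\<^sub>2_V[OF y y_V]])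
        show y_diff: "y *v (?g - ?h) \<in> ?V (Suc i)" by (rule N\<^sub>2_V[OF y Suc.IH])
        show "(x - mat 1) *v (y *v (?g - ?h)) \<in> ?V (Suc i)"
          using V_Suc[OF x y_diff] V_antimono[of "Suc i"] by blast
        show "?g - ?h \<in> ?V (Suc i)" by (rule Suc.IH)
      qed
      finally show ?case .
    qed
    from this[of k\<^sub>2] show ?thesis
      using k\<^sub>2[OF y] by (simp add: matrix_funpow_eq_0_iff)
  qed
  have iterate: "(((*v) (x ** y - mat 1)) ^^ (i * k\<^sub>2)) w \<in> ?V i"
    if "x \<in> N\<^sub>1" "y \<in> N\<^sub>2" for x y w i
  proof (induction i)
    case (Suc i)
    from step[OF that Suc.IH] show ?case by (simp only: mult_Suc funpow_add comp_apply)
  qed simp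
  have "(((*v) (x ** y - mat 1)) ^^ (k\<^sub>1 * k\<^sub>2)) w = 0" if "x \<in> N\<^sub>1" "y \<in> N\<^sub>2" for x y w
    using iterate[OF that, of k\<^sub>1 w] k\<^sub>1 by blast
  then show ?thesis unfolding matrix_funpow_eq_0_iff by blast
qed


section \<open>The Zariski topology on the general linear group\<close>

lemma openin_zariski:
  "openin zariski_topology V \<longleftrightarrow>
     V \<subseteq> {A :: 'k::field^'n^'n. invertible A} \<and> zariski_closed ({A. invertible A} - V)"
  unfolding zariski_topology_def topology_inverse'[OF istopology_zariski] ..

lemma topspace_zariski: "topspace (zariski_topology :: ('k::field^'n^'n) topology) = {A. invertible A}"
proof -
  have "openin zariski_topology {A :: 'k^'n^'n. invertible A}"
    unfolding openin_zariski
    by (auto simp: zariski_closed_def intro!: exI[of _ "{\<lambda>_. 1}"] poly_functions.const)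
  moreover have "U \<subseteq> {A. invertible A}" if "openin zariski_topology U" for U :: "('k^'n^'n) set"
    using that unfolding openin_zariski by blast
  ultimately show ?thesis unfolding topspace_def by blast
qed

lemma closedin_zariski: "closedin zariski_topology Z \<longleftrightarrow> zariski_closed (Z :: ('k::field^'n^'n) set)"
proof -
  have "Z \<subseteq> {A. invertible A}" if "zariski_closed Z" using that by (auto simp: zariski_closed_def)
  then show ?thesis
    unfolding closedin_def topspace_zariski openin_zariski
    by (auto simp: double_diff)
qed

lemma poly_functions_mono:
  assumes "f \<in> poly_functions R" "R \<subseteq> R'"
  shows "f \<in> poly_functions R'"
  using assms by (induction rule: poly_functions.induct) (auto intro: poly_functions.intros)

lemma poly_functions_sum:
  "(\<And>i. i \<in> I \<Longrightarrow> f i \<in> poly_functions UNIV) \<Longrightarrow> (\<lambda>A. \<Sum>i\<in>I. f i A) \<in> poly_functions UNIV"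
  by (induction I rule: infinite_finite_induct)
    (auto intro: poly_functions.intros)

lemma poly_functions_prod:
  "(\<And>i. i \<in> I \<Longrightarrow> f i \<in> poly_functions UNIV) \<Longrightarrow> (\<lambda>A. \<Prod>i\<in>I. f i A) \<in> poly_functions UNIV"
  by (induction I rule: infinite_finite_induct)
    (auto intro: poly_functions.intros)

lemma poly_functions_det:
  fixes \<psi> :: "'k::field^'n^'n \<Rightarrow> 'k^'n^'n"
  assumes "\<And>i j. (\<lambda>A. \<psi> A $ i $ j) \<in> poly_functions UNIV"
  shows "(\<lambda>A. det (\<psi> A)) \<in> poly_functions UNIV"
  unfolding det_def
  by (intro poly_functions_sum poly_functions.mult poly_functions_prod poly_functions.const assms) auto

lemma poly_functions_power: "f \<in> poly_functions UNIV \<Longrightarrow> (\<lambda>A. f A ^ m) \<in> poly_functions UNIV"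
  by (induction m) (auto intro: poly_functions.intros)

text \<open>
  The analogue of \<open>F_regular_on\<close> with coefficients in the whole field: the entries are
  restrictions to \<open>Y\<close> of regular functions on the general linear group.
\<close>

definition rational_on :: "('k::field^'n^'n) set \<Rightarrow> ('k^'n^'n \<Rightarrow> 'k^'n^'n) \<Rightarrow> bool" where
  "rational_on Y \<phi> \<longleftrightarrow>
     (\<forall>i j. \<exists>p \<in> poly_functions UNIV. \<exists>m. \<forall>A\<in>Y. \<phi> A $ i $ j = p A / det A ^ m)"

lemma poly_function_comp_rational:
  assumes f: "f \<in> poly_functions UNIV" and \<phi>: "rational_on Y \<phi>"
    and Y: "Y \<subseteq> {A. invertible A}"
  shows "\<exists>p \<in> poly_functions UNIV. \<exists>m. \<forall>A\<in>Y. f (\<phi> A) = p A / det A ^ m"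
  using f
proof (induction rule: poly_functions.induct)
  case (const c)
  then show ?case by (intro bexI[of _ "\<lambda>_. c"] exI[of _ 0]) (auto intro: poly_functions.const)
next
  case (entry i j)
  then show ?case using \<phi> by (simp add: rational_on_def)
next
  case (add f g)
  then obtain p m q l where p: "p \<in> poly_functions UNIV" "\<forall>A\<in>Y. f (\<phi> A) = p A / det A ^ m"
    and q: "q \<in> poly_functions UNIV" "\<forall>A\<in>Y. g (\<phi> A) = q A / det A ^ l" by blast
  let ?r = "\<lambda>A. p A * det A ^ l + q A * det A ^ m"
  have "?r \<in> poly_functions UNIV"
    by (intro poly_functions.add poly_functions.mult p q poly_functions_power poly_functions_det
        poly_functions.entry)
  moreover have "f (\<phi> A) + g (\<phi> A) = ?r A / det A ^ (m + l)" if "A \<in> Y" for A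
    using p(2) q(2) that Y by (auto simp: invertible_det_nz power_add field_simps)
  ultimately show ?case by (intro bexI[of _ ?r] exI[of _ "m + l"]) simp_all
next
  case (mult f g)
  then obtain p m q l where p: "p \<in> poly_functions UNIV" "\<forall>A\<in>Y. f (\<phi> A) = p A / det A ^ m"
    and q: "q \<in> poly_functions UNIV" "\<forall>A\<in>Y. g (\<phi> A) = q A / det A ^ l" by blast
  have "(\<lambda>A. p A * q A) \<in> poly_functions UNIV" by (intro poly_functions.mult p q)
  moreover have "f (\<phi> A) * g (\<phi> A) = p A * q A / det A ^ (m + l)" if "A \<in> Y" for A
    using p(2) q(2) that by (simp add: power_add)
  ultimately show ?case by (intro bexI[of _ "\<lambda>A. p A * q A"] exI[of _ "m + l"]) simp_all
qed

text \<open>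
  After multiplication by a power of the determinant, an equation for \<open>\<phi> A\<close> becomes a polynomial
  equation for \<open>A\<close>.
\<close>

lemma zariski_closed_preimage:
  assumes Y: "zariski_closed Y" and Z: "zariski_closed Z" and \<phi>: "rational_on Y \<phi>"
    and inv: "\<And>A. A \<in> Y \<Longrightarrow> invertible (\<phi> A)"
  shows "zariski_closed {A \<in> Y. \<phi> A \<in> Z}"
proof -
  obtain S where S: "S \<subseteq> poly_functions UNIV" "Y = {A. invertible A \<and> (\<forall>f\<in>S. f A = 0)}"
    using Y by (auto simp: zariski_closed_def)
  obtain T where T: "T \<subseteq> poly_functions UNIV" "Z = {A. invertible A \<and> (\<forall>f\<in>T. f A = 0)}"
    using Z by (auto simp: zariski_closed_def)
  have Y_inv: "Y \<subseteq> {A. invertible A}" unfolding S(2) by blast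
  have "\<forall>f\<in>T. \<exists>p. p \<in> poly_functions UNIV \<and> (\<exists>m. \<forall>A\<in>Y. f (\<phi> A) = p A / det A ^ m)"
    using poly_function_comp_rational[OF _ \<phi> Y_inv] T(1) by blast
  then obtain p where p: "\<And>f. f \<in> T \<Longrightarrow> p f \<in> poly_functions UNIV"
    "\<And>f. f \<in> T \<Longrightarrow> \<exists>m. \<forall>A\<in>Y. f (\<phi> A) = p f A / det A ^ m"
    by metis
  have zero: "f (\<phi> A) = 0 \<longleftrightarrow> p f A = 0" if f: "f \<in> T" and A: "A \<in> Y" for f A
  proof -
    obtain m where "f (\<phi> A) = p f A / det A ^ m" using p(2)[OF f] A by blast
    moreover have "det A \<noteq> 0" using Y_inv A by (auto simp: invertible_det_nz)
    ultimately show ?thesis by simp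
  qed
  have "{A \<in> Y. \<phi> A \<in> Z} = {A. invertible A \<and> (\<forall>f\<in>S \<union> p ` T. f A = 0)}"
  proof (intro Set.set_eqI iffI)
    fix A assume A: "A \<in> {A \<in> Y. \<phi> A \<in> Z}"
    then have "\<forall>f\<in>T. p f A = 0" using zero T(2) by blast
    then show "A \<in> {A. invertible A \<and> (\<forall>f\<in>S \<union> p ` T. f A = 0)}" using A S(2) by blast
  next
    fix A assume A: "A \<in> {A. invertible A \<and> (\<forall>f\<in>S \<union> p ` T. f A = 0)}"
    then have "A \<in> Y" using S(2) by blast
    moreover have "\<forall>f\<in>T. f (\<phi> A) = 0" using zero[OF _ \<open>A \<in> Y\<close>] A by blast
    ultimately show "A \<in> {A \<in> Y. \<phi> A \<in> Z}" using inv T(2) by blast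
  qed
  moreover have "S \<union> p ` T \<subseteq> poly_functions UNIV" using S(1) p(1) by blast
  ultimately show ?thesis unfolding zariski_closed_def by blast
qed

lemma zariski_closed_GL: "zariski_closed {A :: 'k::field^'n^'n. invertible A}"
  using closedin_topspace[of "zariski_topology :: ('k^'n^'n) topology"]
  by (simp add: topspace_zariski closedin_zariski)

lemma continuous_map_zariski:
  assumes "rational_on {A. invertible A} \<phi>" and inv: "\<And>A. invertible A \<Longrightarrow> invertible (\<phi> A)"
  shows "continuous_map zariski_topology zariski_topology \<phi>"
  unfolding continuous_map_closedin topspace_zariski closedin_zariski
  using zariski_closed_preimage[OF zariski_closed_GL _ assms(1)] inv by auto

lemma rational_on_poly:
  fixes \<phi> :: "'k::field^'n^'n \<Rightarrow> 'k^'n^'n"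
  assumes "\<And>i j. (\<lambda>A. \<phi> A $ i $ j) \<in> poly_functions UNIV"
  shows "rational_on Y \<phi>"
  unfolding rational_on_def
  by (intro allI) (use assms in \<open>auto intro!: bexI[of _ "\<lambda>A. \<phi> A $ _ $ _"] exI[of _ 0]\<close>)

lemma poly_functions_mult_matrix:
  fixes \<phi> \<psi> :: "'k::field^'n^'n \<Rightarrow> 'k^'n^'n"
  assumes "\<And>i j. (\<lambda>A. \<phi> A $ i $ j) \<in> poly_functions UNIV"
    and "\<And>i j. (\<lambda>A. \<psi> A $ i $ j) \<in> poly_functions UNIV"
  shows "(\<lambda>A. (\<phi> A ** \<psi> A) $ i $ j) \<in> poly_functions UNIV"
  unfolding matrix_matrix_mult_def
  by (simp, intro poly_functions_sum poly_functions.mult assms)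

lemma continuous_map_mult_left:
  assumes "invertible (g :: 'k::field^'n^'n)"
  shows "continuous_map zariski_topology zariski_topology ((**) g)"
  by (intro continuous_map_zariski rational_on_poly poly_functions_mult_matrix
      poly_functions.const poly_functions.entry invertible_mult assms UNIV_I)

lemma continuous_map_mult_right:
  assumes "invertible (g :: 'k::field^'n^'n)"
  shows "continuous_map zariski_topology zariski_topology (\<lambda>A. A ** g)"
  by (intro continuous_map_zariski rational_on_poly poly_functions_mult_matrix
      poly_functions.const poly_functions.entry invertible_mult assms UNIV_I)

lemma matrix_inv_works:
  assumes "invertible (A :: 'k::field^'n^'n)"
  shows "A ** matrix_inv A = mat 1" "matrix_inv A ** A = mat 1"
  using someI_ex[OF assms[unfolded invertible_def]] by (simp_all add: matrix_inv_def)

lemma invertible_matrix_inv: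
  assumes "invertible (A :: 'k::field^'n^'n)"
  shows "invertible (matrix_inv A)"
  using matrix_inv_works[OF assms] by (auto simp: invertible_def)

text \<open>
  By Cramer's rule the entries of the inverse are quotients of polynomials by the determinant.
\<close>

lemma continuous_map_matrix_inv:
  "continuous_map zariski_topology zariski_topology (matrix_inv :: 'k::field^'n^'n \<Rightarrow> _)"
proof (rule continuous_map_zariski)
  show "rational_on {A. invertible A} (matrix_inv :: 'k^'n^'n \<Rightarrow> _)"
    unfolding rational_on_def
  proof (intro allI)
    fix i j :: 'n
    define \<psi> where "\<psi> A = (\<chi> r s. if s = i then axis j 1 $ r else A $ r $ s)" for A :: "'k^'n^'n"
    have det_poly: "(\<lambda>A. det (\<psi> A)) \<in> poly_functions UNIV"
    proof (rule poly_functions_det)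
      fix r s show "(\<lambda>A. \<psi> A $ r $ s) \<in> poly_functions UNIV"
        by (cases "s = i") (simp_all add: \<psi>_def poly_functions.const poly_functions.entry)
    qed
    have entry: "matrix_inv A $ i $ j = det (\<psi> A) / det A ^ 1" if "A \<in> {A. invertible A}" for A
    proof -
      have A: "invertible A" using that by simp
      then have d: "det A \<noteq> 0" by (simp add: invertible_det_nz)
      have "A *v (matrix_inv A *v axis j 1) = axis j 1"
        by (simp add: matrix_vector_mul_assoc matrix_inv_works[OF A])
      then have "matrix_inv A *v axis j 1 =
          (\<chi> l. det (\<chi> r s. if s = l then axis j 1 $ r else A $ r $ s) / det A)"
        by (rule cramer[OF d, THEN iffD1])
      then have "(matrix_inv A *v axis j 1) $ i = det (\<psi> A) / det A"
        by (simp only: \<psi>_def vec_lambda_beta)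
      moreover have "(matrix_inv A *v axis j 1) $ i = matrix_inv A $ i $ j"
        by (simp add: matrix_vector_mult_def axis_def if_distrib[of "\<lambda>x. _ * x"] cong: if_cong)
      ultimately show ?thesis by simp
    qed
    show "\<exists>p\<in>poly_functions UNIV. \<exists>m. \<forall>A\<in>{A :: 'k^'n^'n. invertible A}.
        matrix_inv A $ i $ j = p A / det A ^ m"
    proof (rule bexI[OF _ det_poly], rule exI, rule ballI)
      fix A :: "'k^'n^'n" assume "A \<in> {A. invertible A}"
      then show "matrix_inv A $ i $ j = det (\<psi> A) / det A ^ 1" by (rule entry)
    qed
  qed
qed (rule invertible_matrix_inv)

lemma group_GL: "group (GL :: ('k::field^'n^'n) monoid)"
proof (rule groupI)
  fix A :: "'k^'n^'n" assume "A \<in> carrier GL"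
  then have "invertible A" by (simp add: GL_def)
  then show "\<exists>B\<in>carrier GL. B \<otimes>\<^bsub>GL\<^esub> A = \<one>\<^bsub>GL\<^esub>"
    by (intro bexI[of _ "matrix_inv A"]) (simp_all add: GL_def matrix_inv_works invertible_matrix_inv)
qed (auto simp: GL_def invertible_mult matrix_mul_assoc, auto simp: invertible_def)

lemma inv_GL:
  assumes "invertible (A :: 'k::field^'n^'n)"
  shows "inv\<^bsub>GL\<^esub> A = matrix_inv A"
  using group.inv_equality[OF group_GL, of "matrix_inv A" A] assms
  by (simp add: GL_def matrix_inv_works invertible_matrix_inv)

lemma subgroup_GL_iff:
  "subgroup N GL \<longleftrightarrow> N \<subseteq> {A :: 'k::field^'n^'n. invertible A} \<and> mat 1 \<in> N \<and>
     (\<forall>x\<in>N. \<forall>y\<in>N. x ** y \<in> N) \<and> (\<forall>x\<in>N. matrix_inv x \<in> N)"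
proof -
  have "inv\<^bsub>GL\<^esub> x = matrix_inv x" if "N \<subseteq> {A. invertible A}" "x \<in> N" for x
    using that by (intro inv_GL) blast
  then show ?thesis
    unfolding subgroup_def by (auto simp: GL_def)
qed

lemma normal_GL_iff:
  assumes Q: "subgroup Q (GL :: ('k::field^'n^'n) monoid)"
  shows "N \<lhd> GL\<lparr>carrier := Q\<rparr> \<longleftrightarrow>
     subgroup N GL \<and> N \<subseteq> Q \<and> (\<forall>q\<in>Q. \<forall>x\<in>N. q ** x ** matrix_inv q \<in> N)"
proof -
  interpret GL: group GL by (rule group_GL)
  have grp: "group (GL\<lparr>carrier := Q\<rparr>)" using Q by (rule GL.subgroup_imp_group)
  have "inv\<^bsub>GL\<lparr>carrier := Q\<rparr>\<^esub> q = matrix_inv q" if "q \<in> Q" for q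
    using GL.m_inv_consistent[OF Q that] inv_GL[of q] Q that by (auto simp: subgroup_GL_iff)
  moreover have "subgroup N (GL\<lparr>carrier := Q\<rparr>) \<longleftrightarrow> subgroup N GL \<and> N \<subseteq> Q"
    using GL.incl_subgroup[OF Q] GL.subgroup_incl[OF _ Q] subgroup.subset[of N "GL\<lparr>carrier := Q\<rparr>"]
    by auto
  ultimately show ?thesis
    unfolding group.normal_inv_iff[OF grp] by (simp add: GL_def)
qed

lemma matrix_inv_unique:
  assumes "A ** B = mat 1"
  shows "matrix_inv A = (B :: 'k::field^'n^'n)"
proof -
  have "invertible A" using assms matrix_left_right_inverse[of A B] by (auto simp: invertible_def)
  then have "matrix_inv A = matrix_inv A ** (A ** B)" by (simp add: assms)
  also have "\<dots> = B" using matrix_inv_works[OF \<open>invertible A\<close>] by (simp add: matrix_mul_assoc)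
  finally show ?thesis .
qed

text \<open>
  Multiplication is continuous in each variable separately, so it is extended to the closure one
  variable at a time.
\<close>

lemma subgroup_zariski_closure:
  assumes "subgroup N (GL :: ('k::field^'n^'n) monoid)"
  shows "subgroup (zariski_topology closure_of N) GL"
proof -
  let ?C = "zariski_topology closure_of N"
  have N: "N \<subseteq> {A. invertible A}" "mat 1 \<in> N" "\<And>x y. x \<in> N \<Longrightarrow> y \<in> N \<Longrightarrow> x ** y \<in> N"
    "\<And>x. x \<in> N \<Longrightarrow> matrix_inv x \<in> N"
    using assms by (auto simp: subgroup_GL_iff)
  have NC: "N \<subseteq> ?C" using N(1) by (intro closure_of_subset) (simp add: topspace_zariski)
  have C_inv: "?C \<subseteq> {A. invertible A}"
    using closure_of_subset_topspace[of zariski_topology N] by (simp add: topspace_zariski)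
  have CC: "f ` ?C \<subseteq> ?C"
    if f: "continuous_map zariski_topology zariski_topology f" "f ` N \<subseteq> ?C" for f
  proof -
    have "f ` ?C \<subseteq> zariski_topology closure_of (f ` N)"
      by (rule continuous_map_image_closure_subset[OF f(1)])
    also have "\<dots> \<subseteq> ?C" using f(2) by (intro closure_of_minimal) simp_all
    finally show ?thesis .
  qed
  have NC_mult: "x ** y \<in> ?C" if x: "x \<in> N" and y: "y \<in> ?C" for x y
    using CC[OF continuous_map_mult_left[of x]] x y N(1,3) NC by blast
  have "x ** y \<in> ?C" if x: "x \<in> ?C" and y: "y \<in> ?C" for x y
    using CC[OF continuous_map_mult_right[of y]] NC_mult x y C_inv by blast
  moreover have "matrix_inv x \<in> ?C" if "x \<in> ?C" for x
    using CC[OF continuous_map_matrix_inv] N(4) NC that by blast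
  ultimately show ?thesis using C_inv NC N(2) by (auto simp: subgroup_GL_iff)
qed


section \<open>The unipotent radical is a group\<close>

lemma zariski_closed_unipotent:
  "zariski_closed {A :: 'k::field^'n^'n. invertible A \<and> (((**) (A - mat 1)) ^^ k) (mat 1) = 0}"
proof -
  let ?f = "\<lambda>A :: 'k^'n^'n. (((**) (A - mat 1)) ^^ k) (mat 1)"
  have minus: "(\<lambda>A :: 'k^'n^'n. (A - mat 1) $ i $ j) \<in> poly_functions UNIV" for i j
    using poly_functions.add[OF poly_functions.entry[of i j UNIV]
      poly_functions.const[of "- (mat 1 :: 'k^'n^'n) $ i $ j" UNIV]] by simp
  have "(\<lambda>A. ?f A $ i $ j) \<in> poly_functions UNIV" for i j
  proof (induction k arbitrary: i j)
    case (Suc k)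
    show ?case unfolding funpow.simps comp_def by (rule poly_functions_mult_matrix[OF minus Suc.IH])
  qed (simp add: poly_functions.const)
  then have "(\<Union>i j. {\<lambda>A. ?f A $ i $ j}) \<subseteq> poly_functions UNIV" by blast
  moreover have "{A. invertible A \<and> ?f A = 0} =
      {A. invertible A \<and> (\<forall>f\<in>(\<Union>i j. {\<lambda>A. ?f A $ i $ j}). f A = 0)}"
    by (auto simp: vec_eq_iff)
  ultimately show ?thesis unfolding zariski_closed_def by blast
qed

text \<open>
  The subgroup required is the Zariski closure of \<open>N\<^sub>1 N\<^sub>2\<close>. The product \<open>N\<^sub>1 N\<^sub>2\<close> is connected,
  being a union of translates of \<open>N\<^sub>2\<close> that all meet \<open>N\<^sub>1\<close>, and by Kolchin's theorem it consists
  of unipotent matrices with a common exponent. Being normal, connected and unipotent of bounded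
  exponent passes to the closure, and the closure stays inside the closed group \<open>Q\<close>.
\<close>

lemma unipotent_normal_subgroups_directed:
  fixes Q N\<^sub>1 N\<^sub>2 :: "('k::alg_closed_field^'n^'n) set"
  assumes Q: "algebraic_group Q"
    and N\<^sub>1: "unipotent_group N\<^sub>1" "connectedin zariski_topology N\<^sub>1" "N\<^sub>1 \<lhd> GL\<lparr>carrier := Q\<rparr>"
    and N\<^sub>2: "unipotent_group N\<^sub>2" "connectedin zariski_topology N\<^sub>2" "N\<^sub>2 \<lhd> GL\<lparr>carrier := Q\<rparr>"
  shows "\<exists>N. unipotent_group N \<and> connectedin zariski_topology N \<and> N \<lhd> GL\<lparr>carrier := Q\<rparr> \<and>
    (\<forall>x\<in>N\<^sub>1. \<forall>y\<in>N\<^sub>2. x ** y \<in> N)"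
proof -
  have subQ: "subgroup Q GL" and closedQ: "zariski_closed Q" using Q
    by (simp_all add: algebraic_group_def)
  have Q_inv: "invertible q" if "q \<in> Q" for q using subQ that by (auto simp: subgroup_GL_iff)
  have sub\<^sub>1: "subgroup N\<^sub>1 GL" "N\<^sub>1 \<subseteq> Q"
    and conj\<^sub>1: "\<And>q x. q \<in> Q \<Longrightarrow> x \<in> N\<^sub>1 \<Longrightarrow> q ** x ** matrix_inv q \<in> N\<^sub>1"
    using N\<^sub>1(3) by (auto simp: normal_GL_iff[OF subQ])
  have sub\<^sub>2: "subgroup N\<^sub>2 GL" "N\<^sub>2 \<subseteq> Q"
    and conj\<^sub>2: "\<And>q x. q \<in> Q \<Longrightarrow> x \<in> N\<^sub>2 \<Longrightarrow> q ** x ** matrix_inv q \<in> N\<^sub>2"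
    using N\<^sub>2(3) by (auto simp: normal_GL_iff[OF subQ])
  note grp\<^sub>1 = sub\<^sub>1(1)[unfolded subgroup_GL_iff] and grp\<^sub>2 = sub\<^sub>2(1)[unfolded subgroup_GL_iff]
  note grpQ = subQ[unfolded subgroup_GL_iff]
  define D where "D = {x ** y | x y. x \<in> N\<^sub>1 \<and> y \<in> N\<^sub>2}"
  have swap: "y ** x = (y ** x ** matrix_inv y) ** y" if "y \<in> N\<^sub>2" for x y
  proof -
    have "invertible y" using grp\<^sub>2 that by blast
    then show ?thesis by (simp add: matrix_mul_assoc[symmetric] matrix_inv_works)
  qed
  have swap_ex: "\<exists>x'\<in>N\<^sub>1. y ** x = x' ** y" if "x \<in> N\<^sub>1" "y \<in> N\<^sub>2" for x y
    using swap[of y x] conj\<^sub>1[of y x] sub\<^sub>2(2) that by blast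
  have D_Q: "D \<subseteq> Q" unfolding D_def using sub\<^sub>1(2) sub\<^sub>2(2) grpQ by blast
  have "N\<^sub>1 \<subseteq> D"
  proof
    fix x assume "x \<in> N\<^sub>1"
    then have "x ** mat 1 \<in> D" unfolding D_def using grp\<^sub>2 by blast
    then show "x \<in> D" by simp
  qed
  have subD: "subgroup D GL"
    unfolding subgroup_GL_iff
  proof (intro conjI ballI)
    show "D \<subseteq> {A. invertible A}" using D_Q Q_inv by blast
    show "mat 1 \<in> D" using \<open>N\<^sub>1 \<subseteq> D\<close> grp\<^sub>1 by blast
  next
    fix d e assume "d \<in> D" "e \<in> D"
    then obtain x y x' y' where xy: "x \<in> N\<^sub>1" "y \<in> N\<^sub>2" "d = x ** y"
      "x' \<in> N\<^sub>1" "y' \<in> N\<^sub>2" "e = x' ** y'"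
      unfolding D_def by blast
    obtain x'' where x'': "x'' \<in> N\<^sub>1" "y ** x' = x'' ** y" using swap_ex[OF xy(4,2)] by blast
    have "d ** e = x ** (y ** x') ** y'" by (simp add: xy matrix_mul_assoc)
    also have "\<dots> = (x ** x'') ** (y ** y')" by (simp add: x''(2) matrix_mul_assoc)
    finally show "d ** e \<in> D" unfolding D_def using xy x'' grp\<^sub>1 grp\<^sub>2 by blast
  next
    fix d assume "d \<in> D"
    then obtain x y where xy: "x \<in> N\<^sub>1" "y \<in> N\<^sub>2" "d = x ** y" unfolding D_def by blast
    then have inv: "invertible x" "invertible y" using grp\<^sub>1 grp\<^sub>2 by auto
    have "d ** (matrix_inv y ** matrix_inv x) = x ** (y ** matrix_inv y) ** matrix_inv x"
      by (simp add: xy matrix_mul_assoc)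
    then have "matrix_inv d = matrix_inv y ** matrix_inv x"
      by (intro matrix_inv_unique) (simp add: matrix_inv_works inv)
    moreover have y': "matrix_inv y \<in> N\<^sub>2" and "matrix_inv x \<in> N\<^sub>1"
      using xy(1,2) grp\<^sub>1 grp\<^sub>2 by simp_all
    then obtain x' where "x' \<in> N\<^sub>1" "matrix_inv y ** matrix_inv x = x' ** matrix_inv y"
      using swap_ex by blast
    ultimately show "matrix_inv d \<in> D" unfolding D_def using y' by auto
  qed
  have connD: "connectedin zariski_topology D"
  proof -
    have *: "connectedin zariski_topology ((**) x ` N\<^sub>2 \<union> N\<^sub>1)" if x: "x \<in> N\<^sub>1" for x
    proof (rule connectedin_Un)
      have "invertible x" using grp\<^sub>1 x by blast
      then show "connectedin zariski_topology ((**) x ` N\<^sub>2)"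
        by (intro connectedin_continuous_map_image[OF continuous_map_mult_left] N\<^sub>2(2))
      have "x = x ** mat 1" "mat 1 \<in> N\<^sub>2" using grp\<^sub>2 by simp_all
      then show "(**) x ` N\<^sub>2 \<inter> N\<^sub>1 \<noteq> {}" using x by blast
    qed (rule N\<^sub>1(2))
    have "connectedin zariski_topology (\<Union>((\<lambda>x. (**) x ` N\<^sub>2 \<union> N\<^sub>1) ` N\<^sub>1))"
      by (rule connectedin_Union) (use * grp\<^sub>1 in blast)+
    moreover have "\<Union>((\<lambda>x. (**) x ` N\<^sub>2 \<union> N\<^sub>1) ` N\<^sub>1) = D"
    proof
      show "\<Union>((\<lambda>x. (**) x ` N\<^sub>2 \<union> N\<^sub>1) ` N\<^sub>1) \<subseteq> D" using \<open>N\<^sub>1 \<subseteq> D\<close> unfolding D_def by blast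
    qed (unfold D_def, blast)
    ultimately show ?thesis by simp
  qed
  have unip\<^sub>1: "\<exists>m. (((**) (x - mat 1)) ^^ m) (mat 1) = 0" if "x \<in> N\<^sub>1" for x
    using N\<^sub>1(1) that by (simp add: unipotent_group_def)
  have unip\<^sub>2: "\<exists>m. (((**) (x - mat 1)) ^^ m) (mat 1) = 0" if "x \<in> N\<^sub>2" for x
    using N\<^sub>2(1) that by (simp add: unipotent_group_def)
  have "\<exists>k. \<forall>x\<in>N\<^sub>1. \<forall>y\<in>N\<^sub>2. (((**) (x ** y - mat 1)) ^^ k) (mat 1) = 0"
    by (rule unipotent_product[OF _ unip\<^sub>1 _ unip\<^sub>2 _ swap_ex]) (simp_all add: grp\<^sub>1 grp\<^sub>2)
  then obtain k where k: "\<And>x y. x \<in> N\<^sub>1 \<Longrightarrow> y \<in> N\<^sub>2 \<Longrightarrow> (((**) (x ** y - mat 1)) ^^ k) (mat 1) = 0"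
    by blast
  define C where "C = zariski_topology closure_of D"
  have DC: "D \<subseteq> C"
    unfolding C_def using D_Q Q_inv by (intro closure_of_subset) (auto simp: topspace_zariski)
  have "C \<subseteq> {A. invertible A \<and> (((**) (A - mat 1)) ^^ k) (mat 1) = 0}"
    unfolding C_def
  proof (rule closure_of_minimal)
    have "(((**) (d - mat 1)) ^^ k) (mat 1) = 0" if "d \<in> D" for d
      using that k unfolding D_def by blast
    then show "D \<subseteq> {A. invertible A \<and> (((**) (A - mat 1)) ^^ k) (mat 1) = 0}"
      using D_Q Q_inv by blast
  qed (simp add: closedin_zariski zariski_closed_unipotent)
  moreover have subC: "subgroup C GL" unfolding C_def by (rule subgroup_zariski_closure[OF subD])
  moreover have "zariski_closed C"
    unfolding C_def by (simp flip: closedin_zariski)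
  ultimately have "unipotent_group C" by (auto simp: unipotent_group_def algebraic_group_def)
  moreover have "connectedin zariski_topology C" unfolding C_def
    by (rule connectedin_closure_of[OF connD])
  moreover have "C \<lhd> GL\<lparr>carrier := Q\<rparr>"
    unfolding normal_GL_iff[OF subQ]
  proof (intro conjI ballI subC)
    show "C \<subseteq> Q" unfolding C_def using D_Q closedQ
      by (intro closure_of_minimal) (simp_all add: closedin_zariski)
  next
    fix q c assume q: "q \<in> Q" and c: "c \<in> C"
    let ?f = "(\<lambda>A. A ** matrix_inv q) \<circ> (**) q"
    have "continuous_map zariski_topology zariski_topology ?f"
      by (rule continuous_map_compose[OF continuous_map_mult_left continuous_map_mult_right])
        (simp_all add: invertible_matrix_inv Q_inv q)
    then have "?f ` C \<subseteq> zariski_topology closure_of (?f ` D)"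
      unfolding C_def by (rule continuous_map_image_closure_subset)
    also have "?f ` D \<subseteq> D"
    proof
      fix d assume "d \<in> ?f ` D"
      then obtain x y where xy: "x \<in> N\<^sub>1" "y \<in> N\<^sub>2" "d = q ** (x ** y) ** matrix_inv q"
        unfolding D_def by auto
      have "d = (q ** x ** matrix_inv q) ** (q ** y ** matrix_inv q)"
      proof -
        have "(q ** x ** matrix_inv q) ** (q ** y ** matrix_inv q) =
            q ** x ** (matrix_inv q ** q) ** y ** matrix_inv q"
          by (simp add: matrix_mul_assoc)
        then show ?thesis by (simp add: xy(3) matrix_inv_works Q_inv[OF q] matrix_mul_assoc)
      qed
      then show "d \<in> D" unfolding D_def using conj\<^sub>1[OF q xy(1)] conj\<^sub>2[OF q xy(2)] by blast
    qed
    then have "zariski_topology closure_of (?f ` D) \<subseteq> C" unfolding C_def by (rule closure_of_mono)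
    finally show "q ** c ** matrix_inv q \<in> C" using c by auto
  qed
  moreover have "x ** y \<in> C" if "x \<in> N\<^sub>1" "y \<in> N\<^sub>2" for x y using DC that unfolding D_def by blast
  ultimately show ?thesis by blast
qed

text \<open>
  A directed union of subgroups is a subgroup.
\<close>

lemma subgroup_unipotent_radical:
  fixes Q :: "('k::alg_closed_field^'n^'n) set"
  assumes Q: "algebraic_group Q"
  shows "subgroup (unipotent_radical Q) GL"
proof -
  have subQ: "subgroup Q GL" using Q by (simp add: algebraic_group_def)
  have "mat 1 \<in> unipotent_radical Q"
  proof -
    have "subgroup {mat 1} (GL :: ('k^'n^'n) monoid)"
      using matrix_inv_unique[of "mat 1" "mat 1"] by (auto simp: subgroup_GL_iff invertible_def)
    moreover have "{mat 1} = {A :: 'k^'n^'n. invertible A \<and> (((**) (A - mat 1)) ^^ 1) (mat 1) = 0}"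
      by (auto simp: invertible_def)
    then have "zariski_closed {mat 1 :: 'k^'n^'n}" by (simp only: zariski_closed_unipotent)
    moreover have "(((**) (mat 1 - mat 1)) ^^ 1) (mat 1) = (0 :: 'k^'n^'n)" by simp
    ultimately have "unipotent_group {mat 1 :: 'k^'n^'n}"
      unfolding unipotent_group_def algebraic_group_def by blast
    moreover have "connectedin zariski_topology {mat 1 :: 'k^'n^'n}"
      by (auto simp: topspace_zariski invertible_def)
    moreover have "{mat 1} \<lhd> GL\<lparr>carrier := Q\<rparr>"
      using group.one_is_normal[OF group.subgroup_imp_group[OF group_GL subQ]] by (simp add: GL_def)
    ultimately show ?thesis unfolding unipotent_radical_def by blast
  qed
  moreover have "x ** y \<in> unipotent_radical Q"
    if "x \<in> unipotent_radical Q" "y \<in> unipotent_radical Q" for x y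
    using that unipotent_normal_subgroups_directed[OF Q] unfolding unipotent_radical_def by blast
  moreover have "matrix_inv x \<in> unipotent_radical Q \<and> invertible x"
    if x: "x \<in> unipotent_radical Q" for x
  proof -
    obtain N where N: "unipotent_group N" "connectedin zariski_topology N"
      "N \<lhd> GL\<lparr>carrier := Q\<rparr>" "x \<in> N"
      using x unfolding unipotent_radical_def by blast
    then have "matrix_inv x \<in> N" "invertible x"
      by (auto simp: unipotent_group_def algebraic_group_def subgroup_GL_iff)
    with N show ?thesis unfolding unipotent_radical_def by blast
  qed
  ultimately show ?thesis unfolding subgroup_GL_iff by blast
qed

lemma unipotent_radical_subset:
  assumes "algebraic_group Q"
  shows "unipotent_radical Q \<subseteq> Q"
  using assms by (auto simp: unipotent_radical_def normal_GL_iff algebraic_group_def)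


section \<open>Rational points and dominant elements\<close>

lemma map_to_ac_mult:
  "map_matrix to_ac (A ** B) = map_matrix to_ac A ** map_matrix to_ac (B :: 'f::field^'n^'n)"
  by (simp add: vec_eq_iff matrix_matrix_mult_def to_ac_sum)

lemma map_to_ac_one: "map_matrix to_ac (mat 1 :: 'f::field^'n^'n) = mat 1"
  by (simp add: vec_eq_iff mat_def)

lemma map_to_ac_inj: "map_matrix to_ac A = map_matrix to_ac B \<longleftrightarrow> A = (B :: 'f::field^'n^'n)"
  by (simp add: vec_eq_iff)

lemma det_map_to_ac: "det (map_matrix to_ac A) = to_ac (det (A :: 'f::field^'n^'n))"
proof -
  have "to_ac (of_int (sign p) * x) = of_int (sign p) * to_ac x" for p :: "'n \<Rightarrow> 'n" and x :: 'f
    by simp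
  then show ?thesis by (simp add: det_def to_ac_sum to_ac_prod)
qed

lemma invertible_map_to_ac:
  "invertible (map_matrix to_ac A) \<longleftrightarrow> invertible (A :: 'f::field^'n^'n)"
  by (simp add: invertible_det_nz det_map_to_ac)

lemma map_to_ac_matrix_inv:
  assumes "invertible (A :: 'f::field^'n^'n)"
  shows "map_matrix to_ac (matrix_inv A) = matrix_inv (map_matrix to_ac A)"
  using assms
  by (intro matrix_inv_unique[symmetric])
    (simp flip: map_to_ac_mult add: matrix_inv_works map_to_ac_one)

lemma F_points_iff: "A \<in> F_points Z \<longleftrightarrow> map_matrix to_ac A \<in> Z"
  by (simp add: F_points_def)

lemma subgroup_F_points:
  assumes "subgroup Z GL"
  shows "subgroup (F_points Z) (GL :: ('f::field^'n^'n) monoid)"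
  using assms invertible_map_to_ac[where 'f = 'f and 'n = 'n]
  unfolding subgroup_GL_iff
  by (auto simp: F_points_iff map_to_ac_mult map_to_ac_one map_to_ac_matrix_inv)

lemma F_regular_on_imp_rational_on: "F_regular_on G \<phi> \<Longrightarrow> rational_on G \<phi>"
  unfolding F_regular_on_def rational_on_def
  using poly_functions_mono[of _ "range to_ac" UNIV] by (meson subset_UNIV)

text \<open>
  Since \<open>\<sigma>\<close> is its own inverse on \<open>G\<close>, the image of \<open>P\<close> is also the preimage of \<open>P\<close> in \<open>G\<close> under
  a regular map, hence closed.
\<close>

lemma algebraic_group_involution_image:
  assumes G: "algebraic_group G" and \<sigma>: "F_involution G \<sigma>"
    and P: "algebraic_group P" "P \<subseteq> G"
  shows "algebraic_group (\<sigma> ` P)"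
proof -
  have subG: "subgroup G GL" and subP: "subgroup P GL" using G P
    by (simp_all add: algebraic_group_def)
  have iso: "\<sigma> \<in> iso (GL\<lparr>carrier := G\<rparr>) (GL\<lparr>carrier := G\<rparr>)" and inv: "\<And>g. g \<in> G \<Longrightarrow> \<sigma> (\<sigma> g) = g"
    and reg: "F_regular_on G \<sigma>"
    using \<sigma> by (simp_all add: F_involution_def)
  have \<sigma>G: "\<sigma> g \<in> G" if "g \<in> G" for g
    using iso that by (auto simp: iso_def hom_def)
  interpret hom: group_hom "GL\<lparr>carrier := G\<rparr>" "GL\<lparr>carrier := G\<rparr>" \<sigma>
    using group.subgroup_imp_group[OF group_GL subG] iso
    by (simp add: group_hom_def group_hom_axioms_def iso_def)
  have "subgroup (\<sigma> ` P) (GL\<lparr>carrier := G\<rparr>)"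
    using group.subgroup_incl[OF group_GL subP subG P(2)] by (rule hom.subgroup_img_is_subgroup)
  then have "subgroup (\<sigma> ` P) GL" by (rule group.incl_subgroup[OF group_GL subG])
  moreover have "\<sigma> ` P = {A \<in> G. \<sigma> A \<in> P}"
  proof
    show "{A \<in> G. \<sigma> A \<in> P} \<subseteq> \<sigma> ` P" using inv by (auto intro!: image_eqI[OF sym])
  qed (use inv \<sigma>G P(2) in auto)
  moreover have "zariski_closed {A \<in> G. \<sigma> A \<in> P}"
  proof (rule zariski_closed_preimage)
    show "invertible (\<sigma> A)" if "A \<in> G" for A using \<sigma>G[OF that] subG by (auto simp: subgroup_GL_iff)
  qed (use G P reg in \<open>simp_all add: algebraic_group_def F_regular_on_imp_rational_on\<close>)
  ultimately show "algebraic_group (\<sigma> ` P)" by (simp add: algebraic_group_def)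
qed

lemma set_mult_GL: "S <#>\<^bsub>GL\<^esub> T = {x ** y | x y. x \<in> S \<and> y \<in> T}"
  by (auto simp: set_mult_def GL_def)

lemma r_coset_GL: "S #>\<^bsub>GL\<^esub> g = (\<lambda>x. x ** g) ` S"
  by (auto simp: r_coset_def GL_def)

lemma l_coset_GL: "g <#\<^bsub>GL\<^esub> S = (\<lambda>x. g ** x) ` S"
  by (auto simp: l_coset_def GL_def)

text \<open>
  A root vector for \<open>a\<close> is also one for the inverse of \<open>a\<close>, with the inverse eigenvalue. This
  reciprocity exchanges dominant and antidominant elements.
\<close>

lemma root_matrix_inv:
  fixes a :: "'f::field^'n^'n"
  assumes A: "subgroup A GL" and \<alpha>: "\<alpha> \<in> roots A P" and a: "a \<in> F_points A"
  shows "\<alpha> (matrix_inv a) * \<alpha> a = 1"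
proof -
  obtain Y :: "'f^'n^'n" where "Y \<noteq> 0"
    and Y: "\<And>a. a \<in> F_points A \<Longrightarrow> a ** Y ** matrix_inv a = map_matrix ((*) (\<alpha> a)) Y"
    using \<alpha> by (auto simp: roots_def)
  obtain i j where "Y $ i $ j \<noteq> 0" using \<open>Y \<noteq> 0\<close> by (auto simp: vec_eq_iff)
  have subA: "subgroup (F_points A) GL" using A by (rule subgroup_F_points)
  have inv: "invertible a" "matrix_inv a \<in> F_points A" using subA a by (auto simp: subgroup_GL_iff)
  have inv_inv: "matrix_inv (matrix_inv a) = a"
    using matrix_inv_works[OF inv(1)] by (intro matrix_inv_unique)
  have scale: "B ** map_matrix ((*) c) Y ** C = map_matrix ((*) c) (B ** Y ** C)"
    for B C :: "'f^'n^'n" and c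
  proof -
    have "map_matrix ((*) c) D = mat c ** D" for D :: "'f^'n^'n"
      by (simp add: vec_eq_iff matrix_matrix_mult_def mat_def if_distrib[of "\<lambda>x. x * _"] cong: if_cong)
    then show ?thesis by (simp add: matrix_mul_assoc matrix_mat_commute)
  qed
  have "Y = matrix_inv a ** (a ** Y ** matrix_inv a) ** a"
  proof -
    have "matrix_inv a ** (a ** Y ** matrix_inv a) ** a =
        (matrix_inv a ** a) ** Y ** (matrix_inv a ** a)" by (simp add: matrix_mul_assoc)
    then show ?thesis by (simp add: matrix_inv_works[OF inv(1)])
  qed
  also have "\<dots> = map_matrix ((*) (\<alpha> a)) (matrix_inv a ** Y ** matrix_inv (matrix_inv a))"
    unfolding Y[OF a] scale inv_inv ..
  also have "\<dots> = map_matrix ((*) (\<alpha> a)) (map_matrix ((*) (\<alpha> (matrix_inv a))) Y)"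
    unfolding Y[OF inv(2)] ..
  finally have "Y $ i $ j = \<alpha> a * (\<alpha> (matrix_inv a) * Y $ i $ j)"
    by (metis nth_map_matrix)
  with \<open>Y $ i $ j \<noteq> 0\<close> show ?thesis by (simp add: mult.commute)
qed

lemma dominant_matrix_inv:
  assumes v: "nonarch_local_field v" and A: "subgroup A GL" and a: "a \<in> dominant v A P"
  shows "matrix_inv a \<in> antidominant v A P"
proof -
  have mult: "v (x * y) = v x * v y" and zero: "v x = 0 \<longleftrightarrow> x = 0" for x y
    using v by (simp_all add: nonarch_local_field_def)
  have one: "v 1 = 1" using mult[of 1 1] zero[of 1] by simp
  have aA: "a \<in> F_points A" using a by (simp add: dominant_def)
  have "v (\<alpha> (matrix_inv a)) \<le> 1" if \<alpha>: "\<alpha> \<in> simple_roots A P" for \<alpha>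
  proof -
    have "v (\<alpha> (matrix_inv a)) * v (\<alpha> a) = 1"
      using root_matrix_inv[OF A _ aA, of \<alpha> P] \<alpha> mult one by (simp add: simple_roots_def flip: mult)
    moreover have "1 \<le> v (\<alpha> a)" using a \<alpha> by (simp add: dominant_def)
    moreover have "0 \<le> v (\<alpha> (matrix_inv a))" using v by (simp add: nonarch_local_field_def)
    ultimately show ?thesis
      using mult_left_mono[of 1 "v (\<alpha> a)" "v (\<alpha> (matrix_inv a))"] by simp
  qed
  moreover have "matrix_inv a \<in> F_points A"
    using subgroup_F_points[OF A] aA by (simp add: subgroup_GL_iff)
  ultimately show ?thesis by (simp add: antidominant_def)
qed


section \<open>Orbits of a compact open subgroup\<close>

text \<open>
  Write \<open>a k = y a (m u)\<close>, where \<open>y\<close> is the conjugate of \<open>x\<close> by \<open>a\<close>, with \<open>x\<close> in the opposite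
  unipotent part \<open>V\<close>, and \<open>y\<close> lies in \<open>J\<close> because \<open>a\<close> contracts \<open>V\<close>. Rewriting \<open>y\<close> as \<open>h p\<close> with
  \<open>h\<close> in \<open>H\<close> and \<open>p\<close> in the parabolic \<open>P\<^sub>0\<close>, it remains to move \<open>p = m' u'\<close> to the right across
  \<open>a\<close>: the factor \<open>m'\<close> commutes with \<open>a\<close>, and conjugation by the inverse of \<open>a\<close> contracts \<open>U\<close>.
  The argument is meant for the minimal parabolic subgroup, whose Levi subgroup centralizes \<open>a\<close>.
\<close>

lemma dominant_double_coset:
  fixes H J P\<^sub>0 :: "('f::field^'n^'n) set"
  assumes groups: "subgroup H GL" "subgroup J GL" "subgroup P\<^sub>0 GL"
    and V: "V \<subseteq> {A. invertible A}"
    and a: "invertible a" and central: "\<And>m. m \<in> M \<Longrightarrow> m ** a = a ** m"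
    and M: "M \<subseteq> P\<^sub>0" and U: "U \<subseteq> P\<^sub>0" and P\<^sub>0_V: "P\<^sub>0 \<inter> V \<subseteq> {mat 1}"
    and J: "\<And>k. k \<in> J \<Longrightarrow> \<exists>x\<in>J \<inter> V. \<exists>m\<in>J \<inter> M. \<exists>u\<in>J \<inter> U. k = x ** m ** u"
    and JH: "\<And>k. k \<in> J \<Longrightarrow> \<exists>h\<in>J \<inter> H. \<exists>p\<in>J \<inter> P\<^sub>0. k = h ** p"
    and V_J: "\<And>x. x \<in> J \<inter> V \<Longrightarrow> a ** x ** matrix_inv a \<in> J"
    and U_J: "\<And>u. u \<in> J \<inter> U \<Longrightarrow> matrix_inv a ** u ** a \<in> J \<inter> U"
    and k: "k \<in> J"
  shows "\<exists>h\<in>H. \<exists>p\<in>J \<inter> P\<^sub>0. a ** k = h ** a ** p"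
proof -
  note grps = groups[unfolded subgroup_GL_iff]
  obtain x m u where x: "x \<in> J \<inter> V" and m: "m \<in> J \<inter> M" and u: "u \<in> J \<inter> U" and k_eq: "k = x ** m ** u"
    using J[OF k] by blast
  obtain h p where h: "h \<in> J \<inter> H" and p: "p \<in> J \<inter> P\<^sub>0" and hp: "a ** x ** matrix_inv a = h ** p"
    using JH[OF V_J[OF x]] by blast
  obtain x' m' u' where x': "x' \<in> J \<inter> V" and m': "m' \<in> J \<inter> M" and u': "u' \<in> J \<inter> U"
    and p_eq: "p = x' ** m' ** u'"
    using J[of p] p by blast
  have "m' ** u' \<in> P\<^sub>0" using m' u' M U grps by blast
  then have inv: "invertible (m' ** u')" "matrix_inv (m' ** u') \<in> P\<^sub>0" using grps by auto
  have "x' = p ** matrix_inv (m' ** u')"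
  proof -
    have "p ** matrix_inv (m' ** u') = x' ** ((m' ** u') ** matrix_inv (m' ** u'))"
      by (simp add: p_eq matrix_mul_assoc)
    then show ?thesis by (simp add: matrix_inv_works[OF inv(1)])
  qed
  then have "x' \<in> P\<^sub>0" using p inv(2) grps by blast
  then have "x' = mat 1" using x' P\<^sub>0_V by blast
  define w where "w = matrix_inv a ** u' ** a"
  have w: "w \<in> J \<inter> U" unfolding w_def by (rule U_J[OF u'])
  have "a ** k = (a ** x ** matrix_inv a) ** a ** (m ** u)"
  proof -
    have "(a ** x ** matrix_inv a) ** a ** (m ** u) = a ** x ** (matrix_inv a ** a) ** m ** u"
      by (simp add: matrix_mul_assoc)
    then show ?thesis by (simp add: matrix_inv_works[OF a] k_eq matrix_mul_assoc)
  qed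
  also have "\<dots> = h ** m' ** (a ** matrix_inv a) ** u' ** a ** (m ** u)"
    by (simp add: hp p_eq \<open>x' = mat 1\<close> matrix_inv_works[OF a] matrix_mul_assoc)
  also have "\<dots> = h ** (m' ** a) ** w ** (m ** u)" by (simp add: w_def matrix_mul_assoc)
  also have "m' ** a = a ** m'" using central m' by blast
  finally have "a ** k = h ** a ** (m' ** w ** (m ** u))" by (simp add: matrix_mul_assoc)
  moreover have "m' ** w ** (m ** u) \<in> J \<inter> P\<^sub>0"
    using m m' u w M U grps by (simp add: subset_iff)
  ultimately show ?thesis using h by blast
qed

lemma X_P_act_mult: "X_P_act (X_P_act c g) h = X_P_act c (g ** h)"
  by (force simp: X_P_act_def matrix_mul_assoc)

lemma X_P_act_one: "X_P_act c (mat 1) = c"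
  by (force simp: X_P_act_def)

text \<open>
  The classes defining the boundary degeneration absorb elements of the opposite unipotent
  radical; that this radical is closed under products and inverses is what makes each of its
  elements fix the point.
\<close>

lemma X_P_point_opp_radical:
  assumes u: "u \<in> F_points (opp_radical \<sigma> P)"
    and rad: "subgroup (F_points (opp_radical \<sigma> P)) GL"
  shows "X_P_act (X_P_point \<sigma> G H P A x) u = X_P_point \<sigma> G H P A x"
proof -
  let ?U = "F_points (opp_radical \<sigma> P)"
  have sub: "X_P_act (X_P_point \<sigma> G H P A x) u \<subseteq> X_P_point \<sigma> G H P A x" if "u \<in> ?U" for u
  proof
    fix z assume "z \<in> X_P_act (X_P_point \<sigma> G H P A x) u"
    then obtain y m w where z: "z = (y, m ** w ** mat 1 ** u)" "x = X_act y m" "y \<in> X_M \<sigma> G H A"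
      "m \<in> F_points (levi \<sigma> P)" "w \<in> ?U" "mat 1 \<in> F_points G"
      unfolding X_P_act_def X_P_point_def X_P_rel_def by auto
    have "w ** u \<in> ?U" using rad z(5) that by (simp add: subgroup_GL_iff)
    moreover have "z = (y, m ** (w ** u) ** mat 1)" using z(1) by (simp add: matrix_mul_assoc)
    ultimately show "z \<in> X_P_point \<sigma> G H P A x"
      unfolding X_P_point_def X_P_rel_def using z by blast
  qed
  have inv: "matrix_inv u \<in> ?U" "invertible u" using rad u by (auto simp: subgroup_GL_iff)
  have "X_P_point \<sigma> G H P A x = X_P_act (X_P_act (X_P_point \<sigma> G H P A x) (matrix_inv u)) u"
    by (simp add: X_P_act_mult matrix_inv_works[OF inv(2)] X_P_act_one)
  also have "\<dots> \<subseteq> X_P_act (X_P_point \<sigma> G H P A x) u"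
    using sub[OF inv(1)] by (auto simp: X_P_act_def)
  finally show ?thesis using sub[OF u] by blast
qed

text \<open>
  The intersection of \<open>P\<close> with the opposite radical is trivial because an element of it lies in
  the Levi subgroup \<open>P \<inter> \<sigma> P\<close> and in the unipotent radical of \<open>\<sigma> P\<close>.
\<close>

lemma sigma_parabolic_F_points:
  assumes G: "algebraic_group G" and \<sigma>: "F_involution G \<sigma>" and P: "sigma_parabolic \<sigma> G P"
  shows "subgroup (F_points P) GL"
    "F_points (unipotent_radical P) \<subseteq> F_points P"
    "F_points (levi \<sigma> P) \<subseteq> F_points P"
    "subgroup (F_points (opp_radical \<sigma> P)) GL"
    "F_points P \<inter> F_points (opp_radical \<sigma> P) \<subseteq> {mat 1}"
proof -
  have algP: "algebraic_group P" and "P \<subseteq> G" and opp: "opposite P (\<sigma> ` P)"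
    using P by (simp_all add: sigma_parabolic_def parabolic_subgroup_def)
  show "subgroup (F_points P) GL" using algP by (simp add: algebraic_group_def subgroup_F_points)
  show "F_points (unipotent_radical P) \<subseteq> F_points P"
    using unipotent_radical_subset[OF algP] by (auto simp: F_points_iff)
  show "F_points (levi \<sigma> P) \<subseteq> F_points P" by (auto simp: levi_def F_points_iff)
  have algQ: "algebraic_group (\<sigma> ` P)"
    by (rule algebraic_group_involution_image[OF G \<sigma> algP \<open>P \<subseteq> G\<close>])
  show "subgroup (F_points (opp_radical \<sigma> P)) GL"
    unfolding opp_radical_def by (intro subgroup_F_points subgroup_unipotent_radical algQ)
  have "P \<inter> unipotent_radical (\<sigma> ` P) \<subseteq> {mat 1}"
    using opp unipotent_radical_subset[OF algQ] by (auto simp: opposite_def levi_subgroup_def)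
  then show "F_points P \<inter> F_points (opp_radical \<sigma> P) \<subseteq> {mat 1}"
    using map_to_ac_inj[of _ "mat 1"] unfolding opp_radical_def map_to_ac_one
    by (fastforce simp: F_points_iff)
qed

lemma strong_factorization_elems:
  fixes J :: "('f::field^'n^'n) set"
  assumes J: "strong_factorization v \<sigma> H A\<^sub>0 G P\<^sub>0 J" and P: "standard_sigma_parabolic \<sigma> G P\<^sub>0 P"
  shows "k \<in> J \<Longrightarrow> \<exists>x\<in>J \<inter> F_points (opp_radical \<sigma> P). \<exists>m\<in>J \<inter> F_points (levi \<sigma> P).
      \<exists>u\<in>J \<inter> F_points (unipotent_radical P). k = x ** m ** u"
    and "k \<in> J \<Longrightarrow> \<exists>h\<in>J \<inter> F_points H. \<exists>p\<in>J \<inter> F_points P. k = h ** p"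
    and "a \<in> antidominant v A\<^sub>0 P\<^sub>0 \<Longrightarrow> u \<in> J \<inter> F_points (unipotent_radical P) \<Longrightarrow>
      a ** u ** matrix_inv a \<in> J \<inter> F_points (unipotent_radical P)"
    and "a \<in> antidominant v A\<^sub>0 P\<^sub>0 \<Longrightarrow> x \<in> J \<inter> F_points (opp_radical \<sigma> P) \<Longrightarrow>
      matrix_inv a ** x ** a \<in> J \<inter> F_points (opp_radical \<sigma> P)"
proof -
  have *: "bij_betw (\<lambda>(x, y, z). x ** y ** z)
          ((J \<inter> F_points (opp_radical \<sigma> P)) \<times> (J \<inter> F_points (levi \<sigma> P)) \<times>
           (J \<inter> F_points (unipotent_radical P))) J \<and>
        (\<forall>a \<in> antidominant v A\<^sub>0 P\<^sub>0.
          (\<lambda>x. a ** x ** matrix_inv a) ` (J \<inter> F_points (unipotent_radical P))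
            \<subseteq> J \<inter> F_points (unipotent_radical P) \<and>
          (\<lambda>x. matrix_inv a ** x ** a) ` (J \<inter> F_points (opp_radical \<sigma> P))
            \<subseteq> J \<inter> F_points (opp_radical \<sigma> P)) \<and>
        J = (J \<inter> F_points H) <#>\<^bsub>GL\<^esub> (J \<inter> F_points P)"
    using J P by (cases rule: strong_factorization.cases) blast
  have img: "J = (\<lambda>(x, y, z). x ** y ** z) `
      ((J \<inter> F_points (opp_radical \<sigma> P)) \<times> (J \<inter> F_points (levi \<sigma> P)) \<times>
       (J \<inter> F_points (unipotent_radical P)))"
    using * bij_betw_imp_surj_on by metis
  show "\<exists>x\<in>J \<inter> F_points (opp_radical \<sigma> P). \<exists>m\<in>J \<inter> F_points (levi \<sigma> P).
      \<exists>u\<in>J \<inter> F_points (unipotent_radical P). k = x ** m ** u" if "k \<in> J"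
    using that by (subst (asm) img) auto
  have "J = {x ** y |x y. x \<in> J \<inter> F_points H \<and> y \<in> J \<inter> F_points P}"
    using * unfolding set_mult_GL by blast
  then show "\<exists>h\<in>J \<inter> F_points H. \<exists>p\<in>J \<inter> F_points P. k = h ** p" if "k \<in> J"
    using that by blast
  show "a ** u ** matrix_inv a \<in> J \<inter> F_points (unipotent_radical P)"
    if "a \<in> antidominant v A\<^sub>0 P\<^sub>0" "u \<in> J \<inter> F_points (unipotent_radical P)"
    using * that by blast
  show "matrix_inv a ** x ** a \<in> J \<inter> F_points (opp_radical \<sigma> P)"
    if "a \<in> antidominant v A\<^sub>0 P\<^sub>0" "x \<in> J \<inter> F_points (opp_radical \<sigma> P)"
    using * that by blast
qed

theorem lemma10:
  fixes v :: "'f::field \<Rightarrow> real"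
    and G H P\<^sub>0 A\<^sub>0 P A\<^sub>M :: "('f alg_closure^'n^'n) set"
    and \<sigma> :: "'f alg_closure^'n^'n \<Rightarrow> 'f alg_closure^'n^'n"
    and \<mu> :: "('f^'n^'n) set measure"
    and \<nu> :: "(('f^'n^'n) set \<times> ('f^'n^'n)) set measure"
    and K :: "('f^'n^'n) set"
    and a :: "'f^'n^'n"
  assumes "nonarch_local_field v" and "(2::'f) \<noteq> 0"
    and "F_group G" and "connected_reductive G"
    and "F_involution G \<sigma>"
    and "open_F_subgroup (fixed_points \<sigma> G) H"
    and "minimal_sigma_parabolic \<sigma> G P\<^sub>0"
    and "maximal_sigma_split_torus \<sigma> (center (levi \<sigma> P\<^sub>0)) A\<^sub>0"
    and "standard_sigma_parabolic \<sigma> G P\<^sub>0 P"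
    and "maximal_sigma_split_torus \<sigma> (center (levi \<sigma> P)) A\<^sub>M"
    and "invariant_measure (X_topology v G H) X_act (F_points G) \<mu>"
    and "invariant_measure (X_P_topology v \<sigma> G H P A\<^sub>M) X_P_act (F_points G) \<nu>"
    and "compatible_measures \<sigma> G H P A\<^sub>M \<mu> \<nu>"
    and "compact_open_subgroup v G K"
    and "strong_factorization v \<sigma> H A\<^sub>0 G P\<^sub>0 K"
    and "a \<in> dominant v A\<^sub>0 P\<^sub>0"
  shows "((F_points H #>\<^bsub>GL\<^esub> a) <#>\<^bsub>GL\<^esub> K =
         (F_points H #>\<^bsub>GL\<^esub> a) <#>\<^bsub>GL\<^esub> (K \<inter> F_points (levi \<sigma> P))
           <#>\<^bsub>GL\<^esub> (K \<inter> F_points (unipotent_radical P))) \<and>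
         emeasure \<mu> (X_act (F_points H) ` (a <#\<^bsub>GL\<^esub> K)) =
         emeasure \<nu> (X_P_act (X_P_point \<sigma> G H P A\<^sub>M (F_points H)) ` (a <#\<^bsub>GL\<^esub> K))"
proof -
  let ?H = "F_points H" and ?P = "F_points P" and ?M = "F_points (levi \<sigma> P)"
    and ?U = "F_points (unipotent_radical P)" and ?V = "F_points (opp_radical \<sigma> P)"
  have algG: "algebraic_group G" and algH: "algebraic_group H"
    using assms by (simp_all add: F_group_def open_F_subgroup_def)
  have subG: "subgroup (F_points G) GL" and subH: "subgroup ?H GL"
    using algG algH by (simp_all add: algebraic_group_def subgroup_F_points)
  have subK: "subgroup K GL"
    using assms(14) group.incl_subgroup[OF group_GL subG] by (auto simp: compact_open_subgroup_def)
  have std: "standard_sigma_parabolic \<sigma> G P\<^sub>0 P" by fact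
  have parP: "sigma_parabolic \<sigma> G P" and P\<^sub>0P: "P\<^sub>0 \<subseteq> P" using std
    by (simp_all add: standard_sigma_parabolic_def)
  have par\<^sub>0: "sigma_parabolic \<sigma> G P\<^sub>0" using assms by (simp add: minimal_sigma_parabolic_def)
  then have std\<^sub>0: "standard_sigma_parabolic \<sigma> G P\<^sub>0 P\<^sub>0"
    by (simp add: standard_sigma_parabolic_def)
  note P = sigma_parabolic_F_points[OF algG \<open>F_involution G \<sigma>\<close> parP]
    and P\<^sub>0 = sigma_parabolic_F_points[OF algG \<open>F_involution G \<sigma>\<close> par\<^sub>0]
  note fac = strong_factorization_elems[OF \<open>strong_factorization v \<sigma> H A\<^sub>0 G P\<^sub>0 K\<close>]
  have torus: "algebraic_group A\<^sub>0" "A\<^sub>0 \<subseteq> center (levi \<sigma> P\<^sub>0)"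
    using assms(8)
    by (simp_all add: maximal_sigma_split_torus_def sigma_split_torus_def split_torus_def F_group_def)
  have subA: "subgroup A\<^sub>0 GL" using torus(1) by (simp add: algebraic_group_def)
  have aA: "a \<in> F_points A\<^sub>0" using assms by (simp add: dominant_def)
  have a_inv: "invertible a" using subgroup_F_points[OF subA] aA by (auto simp: subgroup_GL_iff)
  have a_P\<^sub>0: "a \<in> F_points P\<^sub>0" using aA torus(2) by (auto simp: F_points_iff center_def levi_def)
  have F\<^sub>0: "F_points P\<^sub>0 \<subseteq> ?P" using P\<^sub>0P by (auto simp: F_points_iff)
  have central: "m ** a = a ** m" if "m \<in> F_points (levi \<sigma> P\<^sub>0)" for m
  proof -
    have "map_matrix to_ac (m ** a) = map_matrix to_ac (a ** m)"
      using that aA torus(2) by (auto simp: F_points_iff center_def map_to_ac_mult)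
    then show ?thesis by (simp only: map_to_ac_inj)
  qed
  have anti: "matrix_inv a \<in> antidominant v A\<^sub>0 P\<^sub>0"
    by (rule dominant_matrix_inv[OF assms(1) subA assms(16)])
  have inv_inv: "matrix_inv (matrix_inv a) = a"
    using matrix_inv_works[OF a_inv] by (intro matrix_inv_unique)
  have conj_V: "a ** x ** matrix_inv a \<in> K \<inter> F_points (opp_radical \<sigma> R)"
    if "standard_sigma_parabolic \<sigma> G P\<^sub>0 R" "x \<in> K \<inter> F_points (opp_radical \<sigma> R)" for x R
    using fac(4)[OF that(1) anti that(2)] by (simp only: inv_inv)
  \<comment> \<open>Every \<open>H a k\<close> is of the form \<open>H a p\<close> with \<open>p\<close> in the smallest standard parabolic, hence in \<open>P\<close>.\<close>
  have main: "\<exists>h\<in>?H. \<exists>p\<in>K \<inter> F_points P\<^sub>0. a ** k = h ** a ** p" if "k \<in> K" for k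
  proof (rule dominant_double_coset[OF subH subK P\<^sub>0(1) _ a_inv central P\<^sub>0(3,2,5) fac(1)[OF std\<^sub>0]
        fac(2)[OF std\<^sub>0] _ _ that])
    show "F_points (opp_radical \<sigma> P\<^sub>0) \<subseteq> {A. invertible A}" using P\<^sub>0(4)
      by (auto simp: subgroup_GL_iff)
    show "a ** x ** matrix_inv a \<in> K" if "x \<in> K \<inter> F_points (opp_radical \<sigma> P\<^sub>0)" for x
      using conj_V[OF std\<^sub>0 that] by blast
    show "matrix_inv a ** u ** a \<in> K \<inter> F_points (unipotent_radical P\<^sub>0)"
      if "u \<in> K \<inter> F_points (unipotent_radical P\<^sub>0)" for u
      using fac(3)[OF std\<^sub>0 anti that] by (simp only: inv_inv)
  qed
  have MU_P: "m ** u \<in> ?P" if "m \<in> K \<inter> ?M" "u \<in> K \<inter> ?U" for m u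
    using that P(1,2,3) by (simp add: subgroup_GL_iff subset_iff)
  \<comment> \<open>The opposite component of an element of \<open>K \<inter> P\<close> lies in \<open>P\<close>, so it is trivial.\<close>
  have KP: "\<exists>m\<in>K \<inter> ?M. \<exists>u\<in>K \<inter> ?U. p = m ** u" if "p \<in> K \<inter> ?P" for p
  proof -
    obtain x m u where xmu: "x \<in> K \<inter> ?V" "m \<in> K \<inter> ?M" "u \<in> K \<inter> ?U" "p = x ** m ** u"
      using fac(1)[OF std] \<open>p \<in> K \<inter> ?P\<close> by blast
    have mu: "m ** u \<in> ?P" using xmu(2,3) by (rule MU_P)
    then have inv: "invertible (m ** u)" "matrix_inv (m ** u) \<in> ?P" using P(1)
      by (auto simp: subgroup_GL_iff)
    have "p ** matrix_inv (m ** u) = x ** ((m ** u) ** matrix_inv (m ** u))"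
      by (simp add: xmu(4) matrix_mul_assoc)
    then have "x = p ** matrix_inv (m ** u)" by (simp add: matrix_inv_works[OF inv(1)])
    then have "x \<in> ?P" using \<open>p \<in> K \<inter> ?P\<close> inv(2) P(1) by (simp add: subgroup_GL_iff)
    then have "x = mat 1" using xmu(1) P(5) by blast
    with xmu show ?thesis by auto
  qed
  have "(?H #>\<^bsub>GL\<^esub> a) <#>\<^bsub>GL\<^esub> K = (?H #>\<^bsub>GL\<^esub> a) <#>\<^bsub>GL\<^esub> (K \<inter> ?M) <#>\<^bsub>GL\<^esub> (K \<inter> ?U)"
  proof
    show "(?H #>\<^bsub>GL\<^esub> a) <#>\<^bsub>GL\<^esub> K \<subseteq> (?H #>\<^bsub>GL\<^esub> a) <#>\<^bsub>GL\<^esub> (K \<inter> ?M) <#>\<^bsub>GL\<^esub> (K \<inter> ?U)"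
    proof
      fix z assume "z \<in> (?H #>\<^bsub>GL\<^esub> a) <#>\<^bsub>GL\<^esub> K"
      then obtain h k where h: "h \<in> ?H" and k: "k \<in> K" and z: "z = h ** a ** k"
        unfolding set_mult_GL r_coset_GL by blast
      obtain h' p where h': "h' \<in> ?H" and p: "p \<in> K \<inter> F_points P\<^sub>0" and ak: "a ** k = h' ** a ** p"
        using main[OF k] by blast
      obtain m u where m: "m \<in> K \<inter> ?M" and u: "u \<in> K \<inter> ?U" and p_eq: "p = m ** u"
        using KP[of p] p F\<^sub>0 by blast
      have "z = h ** (a ** k)" by (simp add: z matrix_mul_assoc)
      also have "\<dots> = (h ** h') ** a ** m ** u" by (simp add: ak p_eq matrix_mul_assoc)
      finally have "z = (h ** h') ** a ** m ** u" .
      moreover have "h ** h' \<in> ?H" using h h' subH by (simp add: subgroup_GL_iff)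
      ultimately show "z \<in> (?H #>\<^bsub>GL\<^esub> a) <#>\<^bsub>GL\<^esub> (K \<inter> ?M) <#>\<^bsub>GL\<^esub> (K \<inter> ?U)"
        unfolding set_mult_GL r_coset_GL using m u by blast
    qed
    show "(?H #>\<^bsub>GL\<^esub> a) <#>\<^bsub>GL\<^esub> (K \<inter> ?M) <#>\<^bsub>GL\<^esub> (K \<inter> ?U) \<subseteq> (?H #>\<^bsub>GL\<^esub> a) <#>\<^bsub>GL\<^esub> K"
    proof
      fix z assume "z \<in> (?H #>\<^bsub>GL\<^esub> a) <#>\<^bsub>GL\<^esub> (K \<inter> ?M) <#>\<^bsub>GL\<^esub> (K \<inter> ?U)"
      then obtain h m u where h: "h \<in> ?H" and mu: "m \<in> K" "u \<in> K" and z: "z = h ** a ** m ** u"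
        unfolding set_mult_GL r_coset_GL by blast
      have "m ** u \<in> K" using mu subK by (simp add: subgroup_GL_iff)
      moreover have "z = h ** a ** (m ** u)" by (simp add: z matrix_mul_assoc)
      ultimately show "z \<in> (?H #>\<^bsub>GL\<^esub> a) <#>\<^bsub>GL\<^esub> K"
        unfolding set_mult_GL r_coset_GL using h by blast
    qed
  qed
  moreover have "emeasure \<mu> (X_act ?H ` (a <#\<^bsub>GL\<^esub> K)) =
      emeasure \<nu> (X_P_act (X_P_point \<sigma> G H P A\<^sub>M ?H) ` (a <#\<^bsub>GL\<^esub> K))"
  proof -
    let ?pt = "X_P_point \<sigma> G H P A\<^sub>M ?H"
    \<comment> \<open>Both orbits are parametrized by \<open>a (K \<inter> P)\<close>, a subset of \<open>P\<close>, where the compatibility applies.\<close>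
    let ?S = "(\<lambda>p. a ** p) ` (K \<inter> ?P)"
    have H_X_M: "?H \<in> X_M \<sigma> G H A\<^sub>M"
    proof -
      have "mat 1 \<in> F_points G" using subG by (simp add: subgroup_GL_iff)
      moreover have "X_act ?H (mat 1) = ?H" by (simp add: X_act_def r_coset_GL)
      moreover have "sigma_split \<sigma> A\<^sub>M"
        using assms(10) by (simp add: maximal_sigma_split_torus_def sigma_split_torus_def)
      moreover have "matrix_inv (mat 1) = (mat 1 :: 'f alg_closure^'n^'n)"
        by (rule matrix_inv_unique) simp
      ultimately show ?thesis
        unfolding X_M_def by (intro CollectI exI[of _ "mat 1"]) (simp add: map_to_ac_one)
    qed
    from bspec[OF assms(13)[unfolded compatible_measures_def] H_X_M]
    obtain f where f: "\<forall>p\<in>?P. f (X_act ?H p) = X_P_act ?pt p"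
      and vol: "\<forall>B \<subseteq> X_act ?H ` ?P. (B \<in> sets \<mu> \<longleftrightarrow> f ` B \<in> sets \<nu>) \<and>
        (B \<in> sets \<mu> \<longrightarrow> emeasure \<nu> (f ` B) = emeasure \<mu> B)"
      by (elim exE conjE)
    have S_P: "?S \<subseteq> ?P" using a_P\<^sub>0 F\<^sub>0 P(1) by (auto simp: subgroup_GL_iff)
    have H_act: "X_act ?H (h ** g) = X_act ?H g" if h: "h \<in> ?H" for h g
    proof -
      have "(\<lambda>x. x ** (h ** g)) ` ?H \<subseteq> (\<lambda>x. x ** g) ` ?H"
        using h subH by (auto simp: matrix_mul_assoc subgroup_GL_iff)
      moreover have "x ** g \<in> (\<lambda>x. x ** (h ** g)) ` ?H" if "x \<in> ?H" for x
      proof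
        have h': "invertible h" "matrix_inv h \<in> ?H" using h subH by (auto simp: subgroup_GL_iff)
        show "x ** matrix_inv h \<in> ?H" using h' that subH by (simp add: subgroup_GL_iff)
        have "x ** matrix_inv h ** (h ** g) = x ** (matrix_inv h ** h) ** g"
          by (simp add: matrix_mul_assoc)
        then show "x ** g = x ** matrix_inv h ** (h ** g)" by (simp add: matrix_inv_works[OF h'(1)])
      qed
      ultimately show ?thesis by (auto simp: X_act_def r_coset_GL)
    qed
    have X_eq: "X_act ?H ` (a <#\<^bsub>GL\<^esub> K) = X_act ?H ` ?S"
    proof
      show "X_act ?H ` (a <#\<^bsub>GL\<^esub> K) \<subseteq> X_act ?H ` ?S"
      proof
        fix z assume "z \<in> X_act ?H ` (a <#\<^bsub>GL\<^esub> K)"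
        then obtain k where k: "k \<in> K" "z = X_act ?H (a ** k)" by (auto simp: l_coset_GL)
        obtain h p where hp: "h \<in> ?H" "p \<in> K \<inter> F_points P\<^sub>0" "a ** k = h ** a ** p"
          using main[OF k(1)] by blast
        have "z = X_act ?H (h ** (a ** p))" by (simp add: k(2) hp(3) matrix_mul_assoc)
        then show "z \<in> X_act ?H ` ?S" using H_act[OF hp(1)] hp(2) F\<^sub>0 by auto
      qed
    qed (auto simp: l_coset_GL)
    have X_P_eq: "X_P_act ?pt ` (a <#\<^bsub>GL\<^esub> K) = X_P_act ?pt ` ?S"
    proof
      show "X_P_act ?pt ` (a <#\<^bsub>GL\<^esub> K) \<subseteq> X_P_act ?pt ` ?S"
      proof
        fix z assume "z \<in> X_P_act ?pt ` (a <#\<^bsub>GL\<^esub> K)"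
        then obtain k where k: "k \<in> K" "z = X_P_act ?pt (a ** k)" by (auto simp: l_coset_GL)
        obtain x m u where xmu: "x \<in> K \<inter> ?V" "m \<in> K \<inter> ?M" "u \<in> K \<inter> ?U" "k = x ** m ** u"
          using fac(1)[OF std k(1)] by blast
        have "a ** x ** matrix_inv a ** (a ** (m ** u)) = a ** x ** (matrix_inv a ** a) ** m ** u"
          by (simp add: matrix_mul_assoc)
        then have "a ** k = a ** x ** matrix_inv a ** (a ** (m ** u))"
          by (simp add: matrix_inv_works[OF a_inv] xmu(4) matrix_mul_assoc)
        then have "z = X_P_act (X_P_act ?pt (a ** x ** matrix_inv a)) (a ** (m ** u))"
          by (simp add: k(2) X_P_act_mult)
        also have "X_P_act ?pt (a ** x ** matrix_inv a) = ?pt"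
          using conj_V[OF std xmu(1)] by (intro X_P_point_opp_radical P(4)) blast
        finally have "z = X_P_act ?pt (a ** (m ** u))" .
        moreover have "m ** u \<in> K \<inter> ?P"
          using xmu(2,3) MU_P subK by (simp add: subgroup_GL_iff)
        ultimately show "z \<in> X_P_act ?pt ` ?S" by blast
      qed
    qed (auto simp: l_coset_GL)
    have "f ` (X_act ?H ` ?S) = X_P_act ?pt ` ?S"
      unfolding image_image[of f] using f S_P by (intro image_cong) auto
    moreover have "X_act ?H ` ?S \<subseteq> X_act ?H ` ?P" using S_P by (rule image_mono)
    with vol have "(X_act ?H ` ?S \<in> sets \<mu> \<longleftrightarrow> f ` (X_act ?H ` ?S) \<in> sets \<nu>) \<and>
        (X_act ?H ` ?S \<in> sets \<mu> \<longrightarrow> emeasure \<nu> (f ` (X_act ?H ` ?S)) = emeasure \<mu> (X_act ?H ` ?S))"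
      by (elim allE impE)
    \<comment> \<open>The two sets are measurable together; a set that is not measurable has volume \<open>0\<close> by convention.\<close>
    ultimately show ?thesis
      unfolding X_eq X_P_eq by (cases "X_act ?H ` ?S \<in> sets \<mu>") (simp_all add: emeasure_notin_sets)
  qed
  ultimately show ?thesis by blast
qed

end
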